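(* Let $\Theta=\mathbb{T}^2$ and let $S:\mathbb{T}^2\to\mathbb{T}^2$ be a $C^2$ Anosov diffeomorphism, and let $F(\theta,y)=(S\theta,f_\theta(y))$ be a skew product satisfying the standing assumptions in the context. Then the set $P$ of pinch points is a union of complete global stable fibres (with respect to $S^{-1}$); that is, if $\theta\in P$, then every $\theta'\in\mathbb{T}^2$ with $\lim_{n\to\infty}d(S^{-n}\theta,S^{-n}\theta')=0$ also belongs to $P$.
   Context: Setting. $\mathbb{T}^2=\mathbb{R}^2/\mathbb{Z}^2$ with its metric $d$, $\mathbb{I}=[-M,M]$ is a compact interval, and $F(\theta,y)=(S\theta,f_\theta(y))$ is a skew product on $\mathbb{T}^2\times\mathbb{I}$ whose fibre maps $f_\theta:\mathbb{I}\to(-M,M)$ are uniformly bounded increasing $C^3$ maps with $\inf_{(\theta,y)}f_\theta'(y)>0$ and $\sup_{(\theta,y)}\mathcal{S}f_\theta(y)<0$, where primes denote derivatives in $y$ and $\mathcal{S}f_\theta=\frac{f_\theta'''}{f_\theta'}-\frac32\big(\frac{f_\theta''}{f_\theta'}\big)^2$. Write $f_\theta^n=f_{S^{n-1}\theta}\circ\cdots\circ f_\theta$. Bounding graphs and pinch points. $\phi_n^{\pm}(\theta):=f^n_{S^{-n}\theta}(\pm M)$, $\phi^{\pm}(\theta):=\lim_{n\to\infty}\phi_n^{\pm}(\theta)$ (monotone limits), $P:=\{\theta:\phi^+(\theta)=\phi^-(\theta)\}$. Hypothesis (A): there is $L$ such that for all $\theta,\theta'$, $\sup_{y\in\mathbb{I}}|f_\theta(y)-f_{\theta'}(y)|+\sup_{y\in\mathbb{I}}|f'_\theta(y)-f'_{\theta'}(y)|\le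 L\,d(\theta,\theta')$. Hypothesis (B): for Anosov surface diffeomorphisms, one takes a Markov partition of $\mathbb{T}^2$ for $S$ and a $C^{1+}$ (i.e. $C^1$ with Hölder continuous derivative) piecewise expanding mixing Markov interval map $\hat S:\mathbb{T}^1\to\mathbb{T}^1$ with finitely many branches that is a factor of $S^{-1}$: $\hat S\circ\Pi=\Pi\circ S^{-1}$ with a measurable $\Pi:\mathbb{T}^2\to\mathbb{T}^1$, together with an injection $\sigma:\mathbb{T}^1\to\mathbb{T}^2$, Hölder continuous on monotonicity intervals of $\hat S$, with $\Pi\circ\sigma=\mathrm{id}_{\mathbb{T}^1}$. Here $\Pi$ is the projection along local stable fibres with respect to $S^{-1}$, i.e. along the connected components of intersections of global stable fibres $W(\theta)=\{\theta':\lim_{n\to\infty}d(S^{-n}\theta,S^{-n}\theta')=0\}$ with the Markov rectangles. There are $C>0$, $\alpha\in(0,1)$ with $d(S^{-n}\theta,S^{-n}\theta')\le C\alpha^n d(\theta,\theta')$ for all $n>0$ and all $\theta,\theta'$ in the same local stable fibre (in particular for $\theta'=\sigma\Pi\theta$). Hypothesis (C): with $Q_f:=\sup_{(\theta,y)}f'_\theta(y)$ and $Q'_f:=\sup_{(\theta,y)}|(\log f'_\theta(y))'|$, one has $\alpha Q_f<1$ and $Q'_f<\infty$. *)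

theory Defs
  imports "HOL-Analysis.Analysis"
begin

section \<open>Flat tori\<close>

text \<open>The type \<open>'a torus\<close> is the quotient of the Euclidean space \<open>'a\<close> by its standard integer
  lattice; thus \<open>real torus\<close> is the circle and \<open>(real^2) torus\<close> the two-dimensional torus.\<close>

definition int_lattice :: "'a::euclidean_space set" where
  "int_lattice = {k. \<forall>b\<in>Basis. k \<bullet> b \<in> \<int>}"

lemma int_lattice_0 [simp]: "0 \<in> int_lattice"
  and int_lattice_minus: "k \<in> int_lattice \<Longrightarrow> - k \<in> int_lattice"
  and int_lattice_add: "k \<in> int_lattice \<Longrightarrow> l \<in> int_lattice \<Longrightarrow> k + l \<in> int_lattice"
  by (auto simp: int_lattice_def inner_add_left)

lemma int_lattice_norm_lt_1:
  assumes "k \<in> int_lattice" "norm k < 1"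
  shows "k = 0"
proof (rule euclidean_eqI)
  fix b :: 'a assume b: "b \<in> Basis"
  then have "\<bar>k \<bullet> b\<bar> < 1" "k \<bullet> b \<in> \<int>"
    using Basis_le_norm[OF b, of k] assms by (auto simp: int_lattice_def)
  then show "k \<bullet> b = 0 \<bullet> b"
    by (auto simp: Ints_def)
qed

quotient_type (overloaded) 'a torus =
  "'a::euclidean_space" / "\<lambda>x y :: 'a. x - y \<in> int_lattice"
  morphisms rep_torus torus_proj
proof (rule equivpI)
  show "reflp (\<lambda>x y :: 'a. x - y \<in> int_lattice)"
    by (auto intro: reflpI)
  show "symp (\<lambda>x y :: 'a. x - y \<in> int_lattice)"
    by (rule sympI) (metis int_lattice_minus minus_diff_eq)
  show "transp (\<lambda>x y :: 'a. x - y \<in> int_lattice)"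
    by (rule transpI) (metis add_diff_eq diff_add_cancel int_lattice_add)
qed

lemma torus_proj_eq_iff: "torus_proj x = torus_proj y \<longleftrightarrow> x - y \<in> int_lattice"
  by (rule torus.abs_eq_iff)

lemma torus_proj_surj: "\<exists>x. torus_proj x = p"
  by (metis Quotient_abs_rep Quotient_torus)

instantiation torus :: (euclidean_space) metric_space
begin

definition dist_torus :: "'a torus \<Rightarrow> 'a torus \<Rightarrow> real" where
  "dist_torus p q = Inf {norm (x - y) | x y. torus_proj x = p \<and> torus_proj y = q}"

definition uniformity_torus :: "('a torus \<times> 'a torus) filter" where
  "uniformity_torus = (INF e\<in>{0 <..}. principal {(x, y). dist x y < e})"

definition open_torus :: "'a torus set \<Rightarrow> bool" where
  "open_torus U \<longleftrightarrow> (\<forall>x\<in>U. \<forall>\<^sub>F (x', y) in uniformity. x' = x \<longrightarrow> y \<in> U)"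

lemma dist_torus_le: "dist (torus_proj x) (torus_proj y) \<le> norm (x - y)"
  unfolding dist_torus_def
  by (rule cInf_lower) (auto intro!: bdd_belowI[where m = 0])

lemma dist_torus_less_iff:
  fixes p q :: "'a torus"
  shows "dist p q < e \<longleftrightarrow> (\<exists>x y. torus_proj x = p \<and> torus_proj y = q \<and> norm (x - y) < e)"
proof -
  have "{norm (x - y) | x y. torus_proj x = p \<and> torus_proj y = q} \<noteq> {}"
    using torus_proj_surj[of p] torus_proj_surj[of q] by auto
  then show ?thesis
    unfolding dist_torus_def
    by (subst cInf_less_iff) (auto intro!: bdd_belowI[where m = 0])
qed

lemma torus_same_rep:
  fixes x y x' y' :: 'a
  assumes "torus_proj y = torus_proj y'"
  obtains x'' where "torus_proj x'' = torus_proj x" "x'' - y' = x - y"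
proof
  show "torus_proj (x + (y' - y)) = torus_proj x"
    using assms by (metis add_diff_cancel_left' torus_proj_eq_iff)
qed simp

instance
proof
  fix p q r :: "'a torus"
  show "dist p q = 0 \<longleftrightarrow> p = q"
  proof
    assume d: "dist p q = 0"
    then have "dist p q < 1/2" by simp
    then obtain x y where xy: "torus_proj x = p" "torus_proj y = q" "norm (x - y) < 1/2"
      unfolding dist_torus_less_iff by blast
    show "p = q"
    proof (rule ccontr)
      assume "p \<noteq> q"
      then have "norm (x - y) > 0" using xy by auto
      then have "dist p q < norm (x - y)" using d by simp
      then obtain u v where uv: "torus_proj u = p" "torus_proj v = q" "norm (u - v) < norm (x - y)"
        unfolding dist_torus_less_iff by blast
      have "x - u \<in> int_lattice" "v - y \<in> int_lattice"
        using xy uv torus_proj_eq_iff by metis+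
      then have "(x - u) + (v - y) \<in> int_lattice" by (rule int_lattice_add)
      then have "(x - y) - (u - v) \<in> int_lattice" by (simp add: algebra_simps)
      moreover have "norm ((x - y) - (u - v)) < 1"
        using norm_triangle_ineq4[of "x - y" "u - v"] xy uv by linarith
      ultimately have "x - y = u - v" using int_lattice_norm_lt_1 by fastforce
      then show False using uv by simp
    qed
  next
    assume "p = q"
    obtain x where "torus_proj x = p" using torus_proj_surj by blast
    then have "dist p q \<le> 0" using dist_torus_le[of x x] \<open>p = q\<close> by simp
    moreover have "\<not> dist p q < 0" unfolding dist_torus_less_iff by auto
    ultimately show "dist p q = 0" by linarith
  qed
  show "dist p q \<le> dist p r + dist q r"
  proof (rule field_le_epsilon)
    fix e :: real assume e: "e > 0"
    have "dist p r < dist p r + e/2" "dist q r < dist q r + e/2" using e by auto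
    then obtain x y u v where *: "torus_proj x = p" "torus_proj y = r" "norm (x - y) < dist p r + e/2"
        "torus_proj u = q" "torus_proj v = r" "norm (u - v) < dist q r + e/2"
      unfolding dist_torus_less_iff by blast
    obtain w where w: "torus_proj w = q" "w - y = u - v"
      using torus_same_rep[of v y u] * by metis
    have "dist p q \<le> norm (x - w)" using dist_torus_le[of x w] * w by simp
    also have "\<dots> = norm ((x - y) - (w - y))" by simp
    also have "\<dots> \<le> norm (x - y) + norm (w - y)" by (rule norm_triangle_ineq4)
    also have "\<dots> \<le> dist p r + dist q r + e" using * w by simp
    finally show "dist p q \<le> dist p r + dist q r + e" .
  qed
qed (simp_all add: uniformity_torus_def open_torus_def)

end

type_synonym T1 = "real torus"
type_synonym T2 = "(real^2) torus"


section \<open>Anosov diffeomorphisms of the torus\<close>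

text \<open>Smoothness and derivatives of a torus map are those of its lifts to the plane; the tangent
  bundle is trivialised, every tangent space being \<open>real^2\<close>.\<close>

definition is_lift :: "(real^2 \<Rightarrow> real^2) \<Rightarrow> (T2 \<Rightarrow> T2) \<Rightarrow> bool" where
  "is_lift G S \<longleftrightarrow> (\<forall>x. S (torus_proj x) = torus_proj (G x))"

definition C2_map :: "(real^2 \<Rightarrow> real^2) \<Rightarrow> bool" where
  "C2_map G \<longleftrightarrow> (\<exists>(G' :: real^2 \<Rightarrow> (real^2) \<Rightarrow>\<^sub>L (real^2))
     (G'' :: real^2 \<Rightarrow> (real^2) \<Rightarrow>\<^sub>L ((real^2) \<Rightarrow>\<^sub>L (real^2))).
     (\<forall>x. (G has_derivative blinfun_apply (G' x)) (at x)) \<and>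
     (\<forall>x. (G' has_derivative blinfun_apply (G'' x)) (at x)) \<and>
     continuous_on UNIV G'')"

definition C2_torus_map :: "(T2 \<Rightarrow> T2) \<Rightarrow> bool" where
  "C2_torus_map S \<longleftrightarrow> (\<exists>G. is_lift G S \<and> C2_map G)"

definition C2_torus_diffeo :: "(T2 \<Rightarrow> T2) \<Rightarrow> bool" where
  "C2_torus_diffeo S \<longleftrightarrow> bij S \<and> C2_torus_map S \<and> C2_torus_map (inv S)"

text \<open>Two lifts that are both differentiable at a point over \<open>\<theta>\<close> differ near that point by a
  constant lattice vector, up to a lattice translation of the argument, so the derivative is unique.\<close>

definition torus_deriv :: "(T2 \<Rightarrow> T2) \<Rightarrow> T2 \<Rightarrow> real^2 \<Rightarrow> real^2" where
  "torus_deriv S \<theta> = (THE D. \<exists>G x. is_lift G S \<and> torus_proj x = \<theta> \<and> (G has_derivative D) (at x))"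

definition anosov_splitting ::
  "(T2 \<Rightarrow> T2) \<Rightarrow> (T2 \<Rightarrow> (real^2) set) \<Rightarrow> (T2 \<Rightarrow> (real^2) set) \<Rightarrow> bool" where
  "anosov_splitting S Es Eu \<longleftrightarrow>
     (\<forall>\<theta>. subspace (Es \<theta>) \<and> subspace (Eu \<theta>) \<and> Es \<theta> \<inter> Eu \<theta> = {0} \<and>
          {a + b | a b. a \<in> Es \<theta> \<and> b \<in> Eu \<theta>} = UNIV) \<and>
     (\<forall>\<theta>. torus_deriv S \<theta> ` Es \<theta> = Es (S \<theta>) \<and> torus_deriv S \<theta> ` Eu \<theta> = Eu (S \<theta>)) \<and>
     (\<exists>c>0. \<exists>\<mu>. 0 < \<mu> \<and> \<mu> < 1 \<and> (\<forall>\<theta> n.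
        (\<forall>v\<in>Es \<theta>. norm (torus_deriv (S ^^ n) \<theta> v) \<le> c * \<mu> ^ n * norm v) \<and>
        (\<forall>v\<in>Eu \<theta>. norm (torus_deriv (inv S ^^ n) \<theta> v) \<le> c * \<mu> ^ n * norm v)))"

definition C2_anosov_diffeo :: "(T2 \<Rightarrow> T2) \<Rightarrow> bool" where
  "C2_anosov_diffeo S \<longleftrightarrow> C2_torus_diffeo S \<and> (\<exists>Es Eu. anosov_splitting S Es Eu)"


section \<open>Fibre maps, bounding graphs and pinch points\<close>

definition deriv_on :: "real set \<Rightarrow> (real \<Rightarrow> real) \<Rightarrow> real \<Rightarrow> real" where
  "deriv_on I g = (\<lambda>y. vector_derivative g (at y within I))"

definition Ck_on :: "nat \<Rightarrow> real set \<Rightarrow> (real \<Rightarrow> real) \<Rightarrow> bool" where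
  "Ck_on k I g \<longleftrightarrow> (\<forall>j<k. (deriv_on I ^^ j) g differentiable_on I) \<and>
                   continuous_on I ((deriv_on I ^^ k) g)"

definition schwarzian_on :: "real set \<Rightarrow> (real \<Rightarrow> real) \<Rightarrow> real \<Rightarrow> real" where
  "schwarzian_on I g y =
     (deriv_on I ^^ 3) g y / deriv_on I g y
       - 3 / 2 * ((deriv_on I ^^ 2) g y / deriv_on I g y) ^ 2"

text \<open>Infima and suprema are taken in the extended reals, so that they always exist.
  Uniform boundedness of the fibre maps is part of their mapping into \<open>{-M<..<M}\<close>.\<close>

definition fibre_maps :: "real \<Rightarrow> (T2 \<Rightarrow> real \<Rightarrow> real) \<Rightarrow> bool" where
  "fibre_maps M f \<longleftrightarrow> 0 < M \<and>
     (\<forall>\<theta>. f \<theta> ` {-M..M} \<subseteq> {-M<..<M} \<and> strict_mono_on {-M..M} (f \<theta>) \<and> Ck_on 3 {-M..M} (f \<theta>)) \<and>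
     (INF (\<theta>, y) \<in> UNIV \<times> {-M..M}. ereal (deriv_on {-M..M} (f \<theta>) y)) > 0 \<and>
     (SUP (\<theta>, y) \<in> UNIV \<times> {-M..M}. ereal (schwarzian_on {-M..M} (f \<theta>) y)) < 0"

fun fibre_iter :: "(T2 \<Rightarrow> T2) \<Rightarrow> (T2 \<Rightarrow> real \<Rightarrow> real) \<Rightarrow> nat \<Rightarrow> T2 \<Rightarrow> real \<Rightarrow> real" where
  "fibre_iter S f 0 \<theta> = id"
| "fibre_iter S f (Suc n) \<theta> = f ((S ^^ n) \<theta>) \<circ> fibre_iter S f n \<theta>"

definition skew_product :: "(T2 \<Rightarrow> T2) \<Rightarrow> (T2 \<Rightarrow> real \<Rightarrow> real) \<Rightarrow> T2 \<times> real \<Rightarrow> T2 \<times> real" where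
  "skew_product S f = (\<lambda>(\<theta>, y). (S \<theta>, f \<theta> y))"

lemma skew_product_iter: "(skew_product S f ^^ n) (\<theta>, y) = ((S ^^ n) \<theta>, fibre_iter S f n \<theta> y)"
  by (induction n) (auto simp: skew_product_def)

definition upper_graph :: "(T2 \<Rightarrow> T2) \<Rightarrow> (T2 \<Rightarrow> real \<Rightarrow> real) \<Rightarrow> real \<Rightarrow> T2 \<Rightarrow> real" where
  "upper_graph S f M \<theta> = lim (\<lambda>n. fibre_iter S f n ((inv S ^^ n) \<theta>) M)"

definition lower_graph :: "(T2 \<Rightarrow> T2) \<Rightarrow> (T2 \<Rightarrow> real \<Rightarrow> real) \<Rightarrow> real \<Rightarrow> T2 \<Rightarrow> real" where
  "lower_graph S f M \<theta> = lim (\<lambda>n. fibre_iter S f n ((inv S ^^ n) \<theta>) (- M))"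

definition pinch_points :: "(T2 \<Rightarrow> T2) \<Rightarrow> (T2 \<Rightarrow> real \<Rightarrow> real) \<Rightarrow> real \<Rightarrow> T2 set" where
  "pinch_points S f M = {\<theta>. upper_graph S f M \<theta> = lower_graph S f M \<theta>}"

definition lipschitz_fibres :: "real \<Rightarrow> (T2 \<Rightarrow> real \<Rightarrow> real) \<Rightarrow> bool" where
  "lipschitz_fibres M f \<longleftrightarrow> (\<exists>L. \<forall>\<theta> \<theta>'.
     (SUP y\<in>{-M..M}. ereal \<bar>f \<theta> y - f \<theta>' y\<bar>) +
     (SUP y\<in>{-M..M}. ereal \<bar>deriv_on {-M..M} (f \<theta>) y - deriv_on {-M..M} (f \<theta>') y\<bar>)
       \<le> ereal (L * dist \<theta> \<theta>'))"

definition Q_sup :: "real \<Rightarrow> (T2 \<Rightarrow> real \<Rightarrow> real) \<Rightarrow> ereal" where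
  "Q_sup M f = (SUP (\<theta>, y) \<in> UNIV \<times> {-M..M}. ereal (deriv_on {-M..M} (f \<theta>) y))"

definition Q'_sup :: "real \<Rightarrow> (T2 \<Rightarrow> real \<Rightarrow> real) \<Rightarrow> ereal" where
  "Q'_sup M f = (SUP (\<theta>, y) \<in> UNIV \<times> {-M..M}.
     ereal \<bar>deriv_on {-M..M} (\<lambda>z. ln (deriv_on {-M..M} (f \<theta>) z)) y\<bar>)"


section \<open>Stable fibres and Markov partitions\<close>

text \<open>Stability refers to \<open>inv S\<close>; accordingly \<open>stable_fibre (inv S) \<theta>\<close> is the global fibre of
  the points whose forward \<open>S\<close>-orbits are asymptotic to that of \<open>\<theta>\<close>.\<close>

definition stable_fibre :: "(T2 \<Rightarrow> T2) \<Rightarrow> T2 \<Rightarrow> T2 set" where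
  "stable_fibre S \<theta> = {\<theta>'. (\<lambda>n. dist ((inv S ^^ n) \<theta>) ((inv S ^^ n) \<theta>')) \<longlonglongrightarrow> 0}"

definition local_stable_fibre :: "(T2 \<Rightarrow> T2) \<Rightarrow> T2 set \<Rightarrow> T2 \<Rightarrow> T2 set" where
  "local_stable_fibre S R \<theta> = connected_component_set (stable_fibre S \<theta> \<inter> R) \<theta>"

text \<open>A rectangle is an embedded closed square carrying the product structure of the two
  foliations.\<close>

definition is_rectangle :: "(T2 \<Rightarrow> T2) \<Rightarrow> T2 set \<Rightarrow> bool" where
  "is_rectangle S R \<longleftrightarrow> (\<exists>h :: real \<times> real \<Rightarrow> T2.
     continuous_on ({0..1} \<times> {0..1}) h \<and> inj_on h ({0..1} \<times> {0..1}) \<and>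
     h ` ({0..1} \<times> {0..1}) = R \<and>
     (\<forall>s\<in>{0..1}. \<forall>s'\<in>{0..1}. \<forall>t\<in>{0..1}. h (s', t) \<in> stable_fibre S (h (s, t))) \<and>
     (\<forall>s\<in>{0..1}. \<forall>t\<in>{0..1}. \<forall>t'\<in>{0..1}. h (s, t') \<in> stable_fibre (inv S) (h (s, t))))"

definition markov_partition :: "(T2 \<Rightarrow> T2) \<Rightarrow> T2 set set \<Rightarrow> bool" where
  "markov_partition S \<R> \<longleftrightarrow>
     finite \<R> \<and> \<Union>\<R> = UNIV \<and> (\<forall>R\<in>\<R>. is_rectangle S R) \<and>
     (\<forall>R\<in>\<R>. \<forall>R'\<in>\<R>. R \<noteq> R' \<longrightarrow> interior R \<inter> interior R' = {}) \<and>
     (\<forall>R\<in>\<R>. \<forall>R'\<in>\<R>. \<forall>\<theta>. \<theta> \<in> interior R \<longrightarrow> inv S \<theta> \<in> interior R' \<longrightarrow>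
        inv S ` local_stable_fibre S R \<theta> \<subseteq> local_stable_fibre S R' (inv S \<theta>) \<and>
        local_stable_fibre (inv S) R' (inv S \<theta>) \<subseteq> inv S ` local_stable_fibre (inv S) R \<theta>)"

definition same_local_stable_fibre :: "(T2 \<Rightarrow> T2) \<Rightarrow> T2 set set \<Rightarrow> T2 \<Rightarrow> T2 \<Rightarrow> bool" where
  "same_local_stable_fibre S \<R> \<theta> \<theta>' \<longleftrightarrow> (\<exists>R\<in>\<R>. \<theta>' \<in> local_stable_fibre S R \<theta>)"

definition hoelder_on :: "real set \<Rightarrow> (real \<Rightarrow> 'b::metric_space) \<Rightarrow> bool" where
  "hoelder_on I g \<longleftrightarrow> (\<exists>H \<gamma>. 0 < \<gamma> \<and> \<gamma> \<le> 1 \<and> (\<forall>s\<in>I. \<forall>t\<in>I. dist (g s) (g t) \<le> H * \<bar>s - t\<bar> powr \<gamma>))"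

text \<open>The pair \<open>(a, b)\<close> stands for the open arc below \<open>{a<..<b}\<close>. The open arcs in \<open>J\<close> are the
  monotonicity intervals of the map; its values at their endpoints are unconstrained here.\<close>

definition arc_of :: "real \<times> real \<Rightarrow> T1 set" where
  "arc_of = (\<lambda>(a, b). torus_proj ` {a<..<b})"

definition arc_partition :: "(real \<times> real) set \<Rightarrow> bool" where
  "arc_partition J \<longleftrightarrow> finite J \<and> (\<forall>(a, b)\<in>J. a < b \<and> b \<le> a + 1) \<and>
     (\<forall>p\<in>J. \<forall>q\<in>J. p \<noteq> q \<longrightarrow> arc_of p \<inter> arc_of q = {}) \<and>
     (\<Union>(a, b)\<in>J. torus_proj ` {a..b}) = (UNIV :: T1 set)"

definition expanding_branch :: "real \<Rightarrow> (T1 \<Rightarrow> T1) \<Rightarrow> real \<times> real \<Rightarrow> bool" where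
  "expanding_branch \<kappa> T = (\<lambda>(a, b). \<exists>g g' :: real \<Rightarrow> real.
     (\<forall>t\<in>{a<..<b}. T (torus_proj t) = torus_proj (g t) \<and>
        (g has_real_derivative g' t) (at t) \<and> \<kappa> \<le> \<bar>g' t\<bar>) \<and>
     hoelder_on {a<..<b} g')"

definition expanding_mixing_markov_map :: "(T1 \<Rightarrow> T1) \<Rightarrow> (real \<times> real) set \<Rightarrow> bool" where
  "expanding_mixing_markov_map T J \<longleftrightarrow>
     arc_partition J \<and>
     (\<exists>\<kappa>>1. \<forall>p\<in>J. expanding_branch \<kappa> T p) \<and>
     (\<forall>p\<in>J. \<forall>q\<in>J. T ` arc_of p \<inter> arc_of q \<noteq> {} \<longrightarrow> arc_of q \<subseteq> T ` arc_of p) \<and>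
     (\<forall>U V. open U \<and> U \<noteq> {} \<and> open V \<and> V \<noteq> {} \<longrightarrow> (\<exists>N. \<forall>n\<ge>N. (T ^^ n) ` U \<inter> V \<noteq> {}))"

text \<open>Every level set of \<open>\<pi>\<close> lies in a local stable fibre. Conversely, a local stable fibre has a
  single image only off the boundary of its rectangle: adjacent closed rectangles overlap in their
  boundaries, where \<open>\<pi>\<close> has to choose between them.\<close>

definition stable_projection :: "(T2 \<Rightarrow> T2) \<Rightarrow> T2 set set \<Rightarrow> (T2 \<Rightarrow> T1) \<Rightarrow> bool" where
  "stable_projection S \<R> \<pi> \<longleftrightarrow>
     \<pi> \<in> borel_measurable borel \<and>
     (\<forall>\<theta> \<theta>'. \<pi> \<theta> = \<pi> \<theta>' \<longrightarrow> same_local_stable_fibre S \<R> \<theta> \<theta>') \<and>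
     (\<forall>R\<in>\<R>. \<forall>\<theta>\<in>interior R. \<forall>\<theta>'\<in>interior R. \<theta>' \<in> local_stable_fibre S R \<theta> \<longrightarrow> \<pi> \<theta> = \<pi> \<theta>')"

definition markov_factor ::
  "(T2 \<Rightarrow> T2) \<Rightarrow> T2 set set \<Rightarrow> (T1 \<Rightarrow> T1) \<Rightarrow> (real \<times> real) set \<Rightarrow> (T2 \<Rightarrow> T1) \<Rightarrow> (T1 \<Rightarrow> T2) \<Rightarrow> bool" where
  "markov_factor S \<R> T J \<pi> \<sigma> \<longleftrightarrow>
     markov_partition S \<R> \<and> expanding_mixing_markov_map T J \<and> stable_projection S \<R> \<pi> \<and>
     T \<circ> \<pi> = \<pi> \<circ> inv S \<and>
     inj \<sigma> \<and> (\<forall>(a, b)\<in>J. hoelder_on {a<..<b} (\<lambda>t. \<sigma> (torus_proj t))) \<and> \<pi> \<circ> \<sigma> = id"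

definition local_fibre_contraction ::
  "(T2 \<Rightarrow> T2) \<Rightarrow> T2 set set \<Rightarrow> real \<Rightarrow> real \<Rightarrow> bool" where
  "local_fibre_contraction S \<R> C \<alpha> \<longleftrightarrow>
     (\<forall>n>0. \<forall>\<theta> \<theta>'. same_local_stable_fibre S \<R> \<theta> \<theta>' \<longrightarrow>
        dist ((inv S ^^ n) \<theta>) ((inv S ^^ n) \<theta>') \<le> C * \<alpha> ^ n * dist \<theta> \<theta>')"

end

theory Submission
  imports Defs
begin

text \<open>Write \<open>\<theta>\<^sub>n\<close>, \<open>\<theta>'\<^sub>n\<close> for the backward orbits of two points on one global stable fibre. A point is pinched
exactly when the images of the whole interval under the compositions
\<open>f \<theta>\<^sub>1 \<circ> \<dots> \<circ> f \<theta>\<^sub>n\<close> shrink to a point, so it is enough to compare the lengths of these images for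
\<open>\<theta>\<close> and \<open>\<theta>'\<close>.

Suppose that \<open>dist \<theta>\<^sub>n \<theta>'\<^sub>n \<le> D * \<rho> ^ n\<close> with \<open>\<rho> * Q < 1\<close>, where \<open>Q\<close> bounds the fibre derivatives.
Start both compositions at the same point of the interval. An error made at level \<open>j\<close> has size of order
\<open>\<rho> ^ j\<close> and is enlarged at most by \<open>Q\<close> at each level that it passes through, so at level \<open>k\<close> the two orbits
are only of order \<open>\<rho> ^ k\<close> apart. As \<open>ln (f' \<theta>)\<close> is Lipschitz in the fibre and \<open>f' \<theta>\<close> is Lipschitz in \<open>\<theta>\<close>,
the logarithms of the derivatives of the two compositions differ by a convergent geometric sum. Hence
the derivatives, and with them the lengths, are comparable uniformly in \<open>n\<close>, and one length tends to
\<open>0\<close> if the other does (\<open>nested_length_comparison\<close>, \<open>pinch_point_transfer\<close>).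

It remains to get the rate \<open>\<rho>\<close> from the assumption that \<open>dist \<theta>\<^sub>n \<theta>'\<^sub>n\<close> tends to \<open>0\<close>, for some \<open>\<rho>\<close> slightly
above \<open>\<alpha>\<close>. The contraction by \<open>\<alpha>\<close> is given on local fibres only. Secants of a local fibre converge to a
vector of \<open>Eu\<close> that the derivative of \<open>inv S ^^ n\<close> shrinks by \<open>\<alpha> ^ n\<close> (\<open>secant_limit\<close>), and \<open>Eu\<close> is a line
(\<open>subspace_of_plane_line\<close>), so the rate holds on all of \<open>Eu\<close>. For two asymptotic orbits, the
vector from one to the other must eventually lie in a cone around the contracted direction, for otherwise it would
grow; inside the cone it shrinks at a rate as close as desired to that of the linear map
(\<open>asymptotic_imp_exponential\<close>). The same cone argument, applied to \<open>S\<close> itself and to the other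
foliation of a Markov rectangle, shows that \<open>Es\<close> is nowhere trivial, which is why \<open>Eu\<close> is a line.\<close>

section \<open>Compositions of increasing interval maps\<close>

text \<open>The composition \<open>g k \<circ> g (k + 1) \<circ> \<dots> \<circ> g (k + n - 1)\<close>: the level \<open>k\<close> counts backward time, so that
  the map at the largest level acts first and further maps are added at the inside, as the definition
  of the bounding graphs requires. The recursion peels off the outermost map.\<close>

fun nested :: "(nat \<Rightarrow> real \<Rightarrow> real) \<Rightarrow> nat \<Rightarrow> nat \<Rightarrow> real \<Rightarrow> real" where
  "nested g k 0 = id"
| "nested g k (Suc n) = g k \<circ> nested g (Suc k) n"

lemma fibre_iter_eq_nested:
  assumes "bij S"
  shows "fibre_iter S f n ((inv S ^^ (n + k)) \<theta>) = nested (\<lambda>i. f ((inv S ^^ i) \<theta>)) (Suc k) n"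
proof (induction n arbitrary: k)
  case 0
  show ?case by simp
next
  case (Suc n)
  have cancel: "(S ^^ n) ((inv S ^^ n) x) = x" for x
    using assms by (metis bij_fn bij_imp_bij_inv bij_inv_eq_iff inv_fn)
  have "(S ^^ n) ((inv S ^^ (Suc n + k)) \<theta>) = (inv S ^^ Suc k) \<theta>"
    using cancel[of "(inv S ^^ Suc k) \<theta>"] by (simp add: funpow_add funpow_swap1)
  then show ?case
    using Suc.IH[of "Suc k"] by simp
qed

lemma nested_in_interval:
  assumes "\<And>k y. y \<in> {a..b} \<Longrightarrow> g k y \<in> {a..b}" "y \<in> {a..b::real}"
  shows "nested g k n y \<in> {a..b}"
  by (induction n arbitrary: k) (use assms in auto)

lemma convergent_nested_endpoints:
  assumes maps: "\<And>k y. y \<in> {a..b} \<Longrightarrow> g k y \<in> {a..b}"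
    and mono: "\<And>k. mono_on {a..b} (g k)" and ab: "a \<le> b"
  shows "convergent (\<lambda>n. nested g k n b)" "convergent (\<lambda>n. nested g k n a)"
proof -
  have I: "nested g k n y \<in> {a..b}" if "y \<in> {a..b}" for k n y
    using nested_in_interval[of a b g y k n] maps that by blast
  have E: "a \<in> {a..b}" "b \<in> {a..b}" using ab by auto
  have "nested g k (Suc n) b \<le> nested g k n b" for n k
  proof (induction n arbitrary: k)
    case 0
    then show ?case using maps[of b k] ab by auto
  next
    case (Suc n)
    show ?case using mono_onD[OF mono I[OF E(2)] I[OF E(2)] Suc.IH[of "Suc k"]] by simp
  qed
  moreover have "norm (nested g k n b) \<le> max \<bar>a\<bar> \<bar>b\<bar>" for n
    using I[OF E(2), of k n] by (simp add: abs_le_iff max_def) linarith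
  ultimately show "convergent (\<lambda>n. nested g k n b)"
    by (intro Bseq_monoseq_convergent BseqI' decseq_imp_monoseq decseq_SucI)
  have "nested g k n a \<le> nested g k (Suc n) a" for n k
  proof (induction n arbitrary: k)
    case 0
    then show ?case using maps[of a k] ab by auto
  next
    case (Suc n)
    show ?case using mono_onD[OF mono I[OF E(1)] I[OF E(1)] Suc.IH[of "Suc k"]] by simp
  qed
  moreover have "norm (nested g k n a) \<le> max \<bar>a\<bar> \<bar>b\<bar>" for n
    using I[OF E(1), of k n] by (simp add: abs_le_iff max_def) linarith
  ultimately show "convergent (\<lambda>n. nested g k n a)"
    by (intro Bseq_monoseq_convergent BseqI' incseq_imp_monoseq incseq_SucI)
qed

text \<open>Distortion control without inverse branches: both compositions start at the same point \<open>y\<close> of \<open>{a..b}\<close>.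
The orbits then stay close at every level, the ratio of the derivatives at \<open>y\<close> is bounded
by the exponential of a geometric sum, and the mean value theorem turns this into a bound on the lengths.\<close>

lemma nested_length_comparison:
  fixes g h g' h' :: "nat \<Rightarrow> real \<Rightarrow> real"
  assumes ab: "a \<le> b"
    and maps: "\<And>k y. y \<in> {a..b} \<Longrightarrow> g k y \<in> {a..b}" "\<And>k y. y \<in> {a..b} \<Longrightarrow> h k y \<in> {a..b}"
    and dg: "\<And>k y. y \<in> {a..b} \<Longrightarrow> (g k has_real_derivative g' k y) (at y within {a..b})"
    and dh: "\<And>k y. y \<in> {a..b} \<Longrightarrow> (h k has_real_derivative h' k y) (at y within {a..b})"
    and pos: "0 < m" "\<And>k y. y \<in> {a..b} \<Longrightarrow> m \<le> g' k y" "\<And>k y. y \<in> {a..b} \<Longrightarrow> 0 \<le> h' k y"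
    and le: "\<And>k y. y \<in> {a..b} \<Longrightarrow> g' k y \<le> Q"
    and near: "\<And>k y. y \<in> {a..b} \<Longrightarrow> \<bar>g k y - h k y\<bar> \<le> D * \<rho> ^ k"
              "\<And>k y. y \<in> {a..b} \<Longrightarrow> \<bar>g' k y - h' k y\<bar> \<le> D * \<rho> ^ k"
    and lnlip: "\<And>k y z. y \<in> {a..b} \<Longrightarrow> z \<in> {a..b} \<Longrightarrow> \<bar>ln (g' k y) - ln (g' k z)\<bar> \<le> Q' * \<bar>y - z\<bar>"
    and \<rho>: "0 < \<rho>" "\<rho> < 1" "\<rho> * Q < 1" and D: "0 \<le> D" and Q': "0 \<le> Q'"
  obtains K where "\<And>n. nested h k n b - nested h k n a \<le> K * (nested g k n b - nested g k n a)"
proof -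
  define K1 where "K1 = D / (1 - \<rho> * Q)"
  have K1: "0 \<le> K1" "D + Q * \<rho> * K1 = K1"
    using \<rho> D by (simp_all add: K1_def field_simps)
  have Q0: "0 \<le> Q" using pos(1) pos(2)[of a k] le[of a k] ab by simp
  note gI = nested_in_interval[of a b g, OF maps(1)] and hI = nested_in_interval[of a b h, OF maps(2)]
  have lip: "\<bar>g k y - g k z\<bar> \<le> Q * \<bar>y - z\<bar>" if "y \<in> {a..b}" "z \<in> {a..b}" for k y z
  proof -
    have "norm (g' k x) \<le> Q" if "x \<in> {a..b}" for x
      using pos(1) pos(2)[OF that, of k] le[OF that, of k] by simp
    then show ?thesis
      using field_differentiable_bound[of "{a..b}" "g k" "g' k" Q y z] dg that by simp
  qed
  \<comment> \<open>\<open>K1\<close> solves \<open>K1 = D + Q * \<rho> * K1\<close>, so the bound reproduces itself when one outer map is added.\<close>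
  have orbits: "\<bar>nested g k n y - nested h k n y\<bar> \<le> K1 * \<rho> ^ k" if y: "y \<in> {a..b}" for k n y
  proof (induction n arbitrary: k)
    case 0
    then show ?case using K1 \<rho> by simp
  next
    case (Suc n)
    let ?u = "nested g (Suc k) n y" and ?v = "nested h (Suc k) n y"
    have uv: "?u \<in> {a..b}" "?v \<in> {a..b}" using gI hI y by blast+
    have "\<bar>g k ?u - h k ?v\<bar> \<le> \<bar>g k ?u - g k ?v\<bar> + \<bar>g k ?v - h k ?v\<bar>" by linarith
    also have "\<dots> \<le> Q * \<bar>?u - ?v\<bar> + D * \<rho> ^ k"
      using lip[OF uv] near(1)[OF uv(2)] by (rule add_mono)
    also have "\<dots> \<le> Q * (K1 * \<rho> ^ Suc k) + D * \<rho> ^ k"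
      using mult_left_mono[OF Suc.IH[of "Suc k"] Q0] by simp
    also have "\<dots> = (D + Q * \<rho> * K1) * \<rho> ^ k" by (simp add: algebra_simps)
    finally show ?case unfolding K1(2) by simp
  qed
  define K2 where "K2 = D / m + Q' * K1"
  \<comment> \<open>In \<open>K2\<close> the term \<open>D / m\<close> pays for replacing \<open>h'\<close> by \<open>g'\<close>, the term \<open>Q' * K1\<close> for replacing \<open>v\<close> by \<open>u\<close>.\<close>
  have step: "h' k v \<le> exp (K2 * \<rho> ^ k) * g' k u"
    if uv: "u \<in> {a..b}" "v \<in> {a..b}" "\<bar>u - v\<bar> \<le> K1 * \<rho> ^ k" for k u v
  proof -
    have p: "0 < g' k v" "0 < g' k u" using pos(1,2) uv(1,2) by (meson less_le_trans)+
    have "h' k v \<le> g' k v + D * \<rho> ^ k" using near(2)[OF uv(2), of k] by linarith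
    also have "\<dots> \<le> g' k v + (D * \<rho> ^ k / m) * g' k v"
    proof -
      have "D * \<rho> ^ k / m * m \<le> D * \<rho> ^ k / m * g' k v"
        using pos(1) pos(2)[OF uv(2)] D \<rho> by (intro mult_left_mono) auto
      then show ?thesis using pos(1) by simp
    qed
    also have "\<dots> = (1 + D * \<rho> ^ k / m) * g' k v" by (simp add: algebra_simps)
    also have "\<dots> \<le> exp (D * \<rho> ^ k / m) * g' k v"
      using p by (intro mult_right_mono exp_ge_add_one_self) auto
    also have "g' k v \<le> exp (Q' * K1 * \<rho> ^ k) * g' k u"
    proof -
      have "ln (g' k v) \<le> Q' * (K1 * \<rho> ^ k) + ln (g' k u)"
        using lnlip[OF uv(2,1), of k] mult_left_mono[OF uv(3) Q'] by (simp add: abs_minus_commute)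
      then have "exp (ln (g' k v)) \<le> exp (Q' * (K1 * \<rho> ^ k) + ln (g' k u))" by simp
      then show ?thesis using p by (simp add: exp_add mult.assoc)
    qed
    finally show ?thesis
      by (simp add: K2_def algebra_simps exp_add add_divide_distrib)
  qed
  have K2: "0 \<le> K2" using D pos(1) Q' K1(1) by (simp add: K2_def)
  define K3 where "K3 = K2 / (1 - \<rho>)"
  have K3: "K2 + \<rho> * K3 = K3" "0 \<le> K3" using \<rho> K2 by (simp_all add: K3_def field_simps)
  \<comment> \<open>\<open>K3 * \<rho> ^ k\<close> is the tail of the series \<open>\<Sum>i. K2 * \<rho> ^ i\<close> from \<open>k\<close> on.\<close>
  have deriv: "\<exists>p q. (nested g k n has_real_derivative p) (at y within {a..b}) \<and>
      (nested h k n has_real_derivative q) (at y within {a..b}) \<and> 0 \<le> p \<and> 0 \<le> q \<and> q \<le> exp (K3 * \<rho> ^ k) * p"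
    if y: "y \<in> {a..b}" for k n y
  proof (induction n arbitrary: k)
    case 0
    have "1 \<le> exp (K3 * \<rho> ^ k)" using K3 \<rho> by simp
    then show ?case unfolding nested.simps id_def by (intro exI[of _ 1]) auto
  next
    case (Suc n)
    let ?u = "nested g (Suc k) n y" and ?v = "nested h (Suc k) n y"
    obtain p q where pq: "(nested g (Suc k) n has_real_derivative p) (at y within {a..b})"
      "(nested h (Suc k) n has_real_derivative q) (at y within {a..b})"
      "0 \<le> p" "0 \<le> q" "q \<le> exp (K3 * \<rho> ^ Suc k) * p"
      using Suc.IH by blast
    have uv: "?u \<in> {a..b}" "?v \<in> {a..b}" using gI hI y by blast+
    have im: "nested g (Suc k) n ` {a..b} \<subseteq> {a..b}" "nested h (Suc k) n ` {a..b} \<subseteq> {a..b}"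
      using gI hI by blast+
    have 1: "(nested g k (Suc n) has_real_derivative g' k ?u * p) (at y within {a..b})"
      unfolding nested.simps
      by (rule DERIV_image_chain[OF DERIV_subset[OF dg[OF uv(1)] im(1)] pq(1)])
    have 2: "(nested h k (Suc n) has_real_derivative h' k ?v * q) (at y within {a..b})"
      unfolding nested.simps
      by (rule DERIV_image_chain[OF DERIV_subset[OF dh[OF uv(2)] im(2)] pq(2)])
    have "\<bar>?u - ?v\<bar> \<le> K1 * \<rho> ^ k"
    proof -
      have "\<rho> ^ Suc k \<le> \<rho> ^ k" using \<rho> by (intro power_decreasing) auto
      show ?thesis using orbits[OF y, of "Suc k" n] mult_left_mono[OF \<open>\<rho> ^ Suc k \<le> \<rho> ^ k\<close> K1(1)] by (rule order_trans)
    qed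
    note s = step[OF uv this]
    have gp: "0 \<le> g' k ?u" using pos(1) pos(2)[OF uv(1), of k] by linarith
    have "h' k ?v * q \<le> (exp (K2 * \<rho> ^ k) * g' k ?u) * (exp (K3 * \<rho> ^ Suc k) * p)"
      using s pq gp pos(3)[OF uv(2), of k] by (intro mult_mono) auto
    also have "\<dots> = exp ((K2 + \<rho> * K3) * \<rho> ^ k) * (g' k ?u * p)"
      by (simp add: algebra_simps exp_add)
    finally have "h' k ?v * q \<le> exp (K3 * \<rho> ^ k) * (g' k ?u * p)" unfolding K3(1) .
    then show ?case using 1 2 gp pos(3)[OF uv(2), of k] pq(3,4) by (metis mult_nonneg_nonneg)
  qed
  let ?K = "exp (K3 * \<rho> ^ k)"
  have "nested h k n b - nested h k n a \<le> ?K * (nested g k n b - nested g k n a)" for n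
  proof -
    have "\<exists>d. ((\<lambda>y. ?K * nested g k n y - nested h k n y) has_real_derivative d) (at y within {a..b}) \<and> 0 \<le> d"
      if "y \<in> {a..b}" for y
    proof -
      obtain p q where pq: "(nested g k n has_real_derivative p) (at y within {a..b})"
        "(nested h k n has_real_derivative q) (at y within {a..b})" "q \<le> ?K * p"
        using deriv[OF \<open>y \<in> _\<close>] by blast
      show ?thesis
        by (rule exI[of _ "?K * p - q"]) (use pq in \<open>auto intro!: derivative_eq_intros\<close>)
    qed
    then obtain d where d: "\<And>y. y \<in> {a..b} \<Longrightarrow>
        ((\<lambda>y. ?K * nested g k n y - nested h k n y) has_real_derivative d y) (at y within {a..b})"
        "\<And>y. y \<in> {a..b} \<Longrightarrow> 0 \<le> d y" by metis
    have "((\<lambda>y. ?K * nested g k n y - nested h k n y) has_derivative (*) (d y)) (at y within {a..b})"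
      if "a \<le> y" "y \<le> b" for y
      using d(1)[of y] that by (simp add: has_field_derivative_def)
    from mvt_very_simple[OF ab this] obtain y where "y \<in> {a..b}"
      "?K * nested g k n b - nested h k n b - (?K * nested g k n a - nested h k n a) = d y * (b - a)"
      by blast
    moreover have "0 \<le> d y * (b - a)" using d(2) \<open>y \<in> {a..b}\<close> ab by simp
    ultimately have "?K * nested g k n a - nested h k n a \<le> ?K * nested g k n b - nested h k n b"
      by linarith
    then show ?thesis by (simp add: algebra_simps)
  qed
  then show thesis by (rule that)
qed


text \<open>The bounding graphs are defined through \<open>lim\<close>, which carries information only for convergent sequences;
convergence comes from monotonicity in \<open>n\<close>.\<close>

lemma pinch_points_iff:
  assumes "bij S" "fibre_maps M f"
  defines "g \<equiv> \<lambda>\<theta> k. f ((inv S ^^ k) \<theta>)"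
  shows "\<theta> \<in> pinch_points S f M \<longleftrightarrow>
    (\<lambda>n. nested (g \<theta>) 1 n M - nested (g \<theta>) 1 n (- M)) \<longlonglongrightarrow> 0"
proof -
  have "f \<theta> ` {-M..M} \<subseteq> {-M<..<M}" for \<theta>
    using assms(2) by (simp add: fibre_maps_def)
  have "g \<theta> k y \<in> {-M..M}" if "y \<in> {-M..M}" for k y
    using that subsetD[OF \<open>\<And>\<theta>. f \<theta> ` {-M..M} \<subseteq> {-M<..<M}\<close> imageI[OF that]]
    unfolding g_def by (simp add: less_imp_le)
  moreover have "mono_on {-M..M} (g \<theta> k)" for k
    using assms(2) by (simp add: fibre_maps_def g_def strict_mono_on_imp_mono_on)
  ultimately have c: "convergent (\<lambda>n. nested (g \<theta>) 1 n M)" "convergent (\<lambda>n. nested (g \<theta>) 1 n (- M))"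
    using convergent_nested_endpoints[of "-M" M "g \<theta>" 1] assms(2) by (auto simp: fibre_maps_def)
  have "fibre_iter S f n ((inv S ^^ n) \<theta>) = nested (g \<theta>) 1 n" for n
    using fibre_iter_eq_nested[OF assms(1), of f n 0 \<theta>] by (simp add: g_def)
  then have "upper_graph S f M \<theta> = lim (\<lambda>n. nested (g \<theta>) 1 n M)"
    "lower_graph S f M \<theta> = lim (\<lambda>n. nested (g \<theta>) 1 n (- M))"
    by (simp_all add: upper_graph_def lower_graph_def)
  moreover have "(\<lambda>n. nested (g \<theta>) 1 n M - nested (g \<theta>) 1 n (- M)) \<longlonglongrightarrow>
      lim (\<lambda>n. nested (g \<theta>) 1 n M) - lim (\<lambda>n. nested (g \<theta>) 1 n (- M))"
    using c by (intro tendsto_diff) (simp_all add: convergent_LIMSEQ_iff)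
  ultimately show ?thesis
    unfolding pinch_points_def using LIMSEQ_unique by fastforce
qed

text \<open>The hypotheses on the skew product are translated from the extended reals to the real constants of the
length comparison: \<open>m\<close> lies below all fibre derivatives, and \<open>q\<close> bounds the derivative of \<open>ln (f' \<theta>)\<close>.\<close>

lemma pinch_point_transfer:
  assumes bij: "bij S" and f: "fibre_maps M f" and lip: "lipschitz_fibres M f"
    and Q: "Q_sup M f \<le> ereal Q" and Q': "Q'_sup M f < \<infinity>"
    and \<rho>: "0 < \<rho>" "\<rho> < 1" "\<rho> * Q < 1"
    and d: "\<And>n. dist ((inv S ^^ n) \<theta>) ((inv S ^^ n) \<theta>') \<le> D * \<rho> ^ n"
    and \<theta>: "\<theta> \<in> pinch_points S f M"
  shows "\<theta>' \<in> pinch_points S f M"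
proof -
  let ?I = "{-M..M}"
  let ?d = "\<lambda>\<theta>. deriv_on ?I (f \<theta>)"
  have M: "0 < M" and maps: "f \<theta> ` ?I \<subseteq> {-M<..<M}" and C3: "Ck_on 3 ?I (f \<theta>)" for \<theta>
    using f by (auto simp: fibre_maps_def)
  have f': "f \<theta> y \<in> ?I" if "y \<in> ?I" for \<theta> y
    using maps[of \<theta>] that by force
  have ne: "at y within ?I \<noteq> bot" if "y \<in> ?I" for y
    using M that by (simp add: trivial_limit_within islimpt_Icc)
  have der: "(g has_real_derivative deriv_on ?I g y) (at y within ?I)"
    if "g differentiable_on ?I" "y \<in> ?I" for g y
    using that vector_derivative_works[of g "at y within ?I"]
    by (simp add: deriv_on_def differentiable_on_def has_real_derivative_iff_has_vector_derivative)
  have d1: "f \<theta> differentiable_on ?I" "?d \<theta> differentiable_on ?I" for \<theta>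
    using C3[of \<theta>] unfolding Ck_on_def
    by (metis funpow_0 zero_less_numeral, metis One_nat_def funpow_0 funpow_simps_right(2) comp_def one_less_numeral_iff semiring_norm(77))
  obtain m where m: "0 < m" "ereal m < (INF (\<theta>, y) \<in> UNIV \<times> ?I. ereal (?d \<theta> y))"
    using f ereal_dense2[of 0 "INF (\<theta>, y) \<in> UNIV \<times> ?I. ereal (?d \<theta> y)"]
    by (auto simp: fibre_maps_def)
  have lower: "m \<le> ?d \<theta> y" if "y \<in> ?I" for \<theta> y
  proof -
    have "(INF (\<theta>, y) \<in> UNIV \<times> ?I. ereal (?d \<theta> y)) \<le> ereal (?d \<theta> y)"
      by (rule INF_lower2[of "(\<theta>, y)"]) (use that in auto)
    with m(2) have "ereal m \<le> ereal (?d \<theta> y)" by (meson less_imp_le order_trans)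
    then show ?thesis by simp
  qed
  have upper: "?d \<theta> y \<le> Q" if "y \<in> ?I" for \<theta> y
  proof -
    have "ereal (?d \<theta> y) \<le> Q_sup M f" unfolding Q_sup_def
      by (rule SUP_upper2[of "(\<theta>, y)"]) (use that in auto)
    with Q have "ereal (?d \<theta> y) \<le> ereal Q" by (rule order_trans[rotated])
    then show ?thesis by simp
  qed
  obtain q where q: "0 \<le> q" "Q'_sup M f \<le> ereal q"
  proof (cases "Q'_sup M f")
    case (real r)
    then show ?thesis using that[of "max r 0"] by simp
  qed (use Q' that[of 0] in auto)
  have lnlip: "\<bar>ln (?d \<theta> y) - ln (?d \<theta> z)\<bar> \<le> q * \<bar>y - z\<bar>" if yz: "y \<in> ?I" "z \<in> ?I" for \<theta> y z
  proof -
    let ?l = "\<lambda>z. ln (?d \<theta> z)"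
    have diff: "?l differentiable_on ?I"
      unfolding differentiable_on_def
    proof
      fix x assume x: "x \<in> ?I"
      have "(?l has_real_derivative 1 / ?d \<theta> x * deriv_on ?I (?d \<theta>) x) (at x within ?I)"
        using lower[OF x, of \<theta>] m(1) der[OF d1(2) x, of \<theta>]
        by (auto intro!: derivative_eq_intros)
      then show "?l differentiable at x within ?I"
        by (auto simp: has_field_derivative_def differentiable_def)
    qed
    have "norm (deriv_on ?I ?l x) \<le> q" if "x \<in> ?I" for x
    proof -
      have "ereal \<bar>deriv_on ?I ?l x\<bar> \<le> Q'_sup M f" unfolding Q'_sup_def
        by (rule SUP_upper2[of "(\<theta>, x)"]) (use that in auto)
      with q(2) have "ereal \<bar>deriv_on ?I ?l x\<bar> \<le> ereal q" by (rule order_trans[rotated])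
      then show ?thesis by simp
    qed
    then show ?thesis
      using field_differentiable_bound[of ?I ?l "deriv_on ?I ?l" q y z] der[OF diff] yz by simp
  qed
  obtain L where L: "\<And>\<theta> \<theta>'. (SUP y\<in>?I. ereal \<bar>f \<theta> y - f \<theta>' y\<bar>) + (SUP y\<in>?I. ereal \<bar>?d \<theta> y - ?d \<theta>' y\<bar>)
       \<le> ereal (L * dist \<theta> \<theta>')"
    using lip unfolding lipschitz_fibres_def by blast
  have near: "\<bar>f \<theta> y - f \<theta>' y\<bar> \<le> L * dist \<theta> \<theta>'" "\<bar>?d \<theta> y - ?d \<theta>' y\<bar> \<le> L * dist \<theta> \<theta>'"
    if y: "y \<in> ?I" for \<theta> \<theta>' y
  proof -
    let ?A = "SUP y\<in>?I. ereal \<bar>f \<theta> y - f \<theta>' y\<bar>" and ?B = "SUP y\<in>?I. ereal \<bar>?d \<theta> y - ?d \<theta>' y\<bar>"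
    have AB: "ereal \<bar>f \<theta> y - f \<theta>' y\<bar> \<le> ?A" "ereal \<bar>?d \<theta> y - ?d \<theta>' y\<bar> \<le> ?B"
      by (auto intro!: SUP_upper2[OF y])
    then have "0 \<le> ?A" "0 \<le> ?B"
      using order_trans[of 0 "ereal \<bar>f \<theta> y - f \<theta>' y\<bar>" ?A] order_trans[of 0 "ereal \<bar>?d \<theta> y - ?d \<theta>' y\<bar>" ?B]
      by auto
    then have "?A \<le> ?A + ?B" "?B \<le> ?A + ?B"
      using add_increasing add_increasing2 by blast+
    then have "ereal \<bar>f \<theta> y - f \<theta>' y\<bar> \<le> ereal (L * dist \<theta> \<theta>')"
      "ereal \<bar>?d \<theta> y - ?d \<theta>' y\<bar> \<le> ereal (L * dist \<theta> \<theta>')"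
      using AB L[of \<theta> \<theta>'] by (meson order_trans)+
    then show "\<bar>f \<theta> y - f \<theta>' y\<bar> \<le> L * dist \<theta> \<theta>'" "\<bar>?d \<theta> y - ?d \<theta>' y\<bar> \<le> L * dist \<theta> \<theta>'"
      by simp_all
  qed
  have bound: "L * dist ((inv S ^^ k) \<theta>) ((inv S ^^ k) \<theta>') \<le> (\<bar>L\<bar> * \<bar>D\<bar>) * \<rho> ^ k" for k
  proof -
    have "L * dist ((inv S ^^ k) \<theta>) ((inv S ^^ k) \<theta>') \<le> \<bar>L\<bar> * (\<bar>D\<bar> * \<rho> ^ k)"
    proof (rule mult_mono)
      have "D * \<rho> ^ k \<le> \<bar>D\<bar> * \<rho> ^ k" using \<rho> by (intro mult_right_mono) auto
      then show "dist ((inv S ^^ k) \<theta>) ((inv S ^^ k) \<theta>') \<le> \<bar>D\<bar> * \<rho> ^ k" using d[of k] by linarith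
    qed auto
    then show ?thesis by simp
  qed
  let ?g = "\<lambda>\<theta> k. f ((inv S ^^ k) \<theta>)"
  have "\<exists>K. \<forall>n. nested (?g \<theta>') 1 n M - nested (?g \<theta>') 1 n (- M)
      \<le> K * (nested (?g \<theta>) 1 n M - nested (?g \<theta>) 1 n (- M))"
  proof (rule nested_length_comparison[of "-M" M "?g \<theta>" "?g \<theta>'" "\<lambda>k. ?d ((inv S ^^ k) \<theta>)"
        "\<lambda>k. ?d ((inv S ^^ k) \<theta>')" m Q "\<bar>L\<bar> * \<bar>D\<bar>" \<rho> q 1])
    show "\<bar>?g \<theta> k y - ?g \<theta>' k y\<bar> \<le> \<bar>L\<bar> * \<bar>D\<bar> * \<rho> ^ k" if "y \<in> ?I" for k y
      using near(1)[OF that] bound[of k] by (rule order_trans)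
    show "\<bar>?d ((inv S ^^ k) \<theta>) y - ?d ((inv S ^^ k) \<theta>') y\<bar> \<le> \<bar>L\<bar> * \<bar>D\<bar> * \<rho> ^ k" if "y \<in> ?I" for k y
      using near(2)[OF that] bound[of k] by (rule order_trans)
    show "0 \<le> ?d ((inv S ^^ k) \<theta>') y" if "y \<in> ?I" for k y
      using lower[OF that] m(1) by (meson less_imp_le order_trans)
    show ?thesis if "\<And>n. nested (?g \<theta>') 1 n M - nested (?g \<theta>') 1 n (- M)
        \<le> K * (nested (?g \<theta>) 1 n M - nested (?g \<theta>) 1 n (- M))" for K
      by (intro exI allI) (rule that)
  qed (use M f' der[OF d1(1)] m(1) lower upper lnlip \<rho> q(1) in \<open>simp_all\<close>)
  then obtain K where "\<forall>n. nested (?g \<theta>') 1 n M - nested (?g \<theta>') 1 n (- M)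
      \<le> K * (nested (?g \<theta>) 1 n M - nested (?g \<theta>) 1 n (- M))" by (rule exE)
  note K = this[rule_format]
  have "(\<lambda>n. nested (?g \<theta>') 1 n M - nested (?g \<theta>') 1 n (- M)) \<longlonglongrightarrow> 0"
  proof (rule tendsto_sandwich)
    have mono: "mono_on ?I (nested (?g \<theta>') k n)" for k n
    proof (induction n arbitrary: k)
      case (Suc n)
      have "mono_on ?I (f \<theta>)" for \<theta>
        using f by (simp add: fibre_maps_def strict_mono_on_imp_mono_on)
      then show ?case
        unfolding nested.simps
        using Suc[of "Suc k"] nested_in_interval[of "-M" M "?g \<theta>'" _ "Suc k" n, OF f']
        by (intro monotone_on_o[where A = ?I]) auto
    qed (simp add: mono_on_def)
    show "\<forall>\<^sub>F n in sequentially. 0 \<le> nested (?g \<theta>') 1 n M - nested (?g \<theta>') 1 n (- M)"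
      using mono_onD[OF mono, of "-M" M] M by simp
    show "(\<lambda>n. K * (nested (?g \<theta>) 1 n M - nested (?g \<theta>) 1 n (- M))) \<longlonglongrightarrow> 0"
      using \<theta> pinch_points_iff[OF bij f] by (intro tendsto_mult_right_zero) simp
  qed (use K in auto)
  then show ?thesis using pinch_points_iff[OF bij f] by simp
qed

section \<open>Torus maps seen through displacement vectors\<close>

text \<open>Differences of nearby torus points as plane vectors. Every point over \<open>p\<close> may serve
  as the base point, and two displacements between the same points differ by a lattice vector.\<close>

definition displacement :: "T2 \<Rightarrow> T2 \<Rightarrow> real^2 \<Rightarrow> bool" where
  "displacement p q w \<longleftrightarrow> (\<exists>x. torus_proj x = p \<and> torus_proj (x + w) = q)"

lemma displacementD:
  assumes "displacement p q w" "torus_proj x = p"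
  shows "torus_proj (x + w) = q"
proof -
  obtain y where "torus_proj y = p" "torus_proj (y + w) = q"
    using assms(1) by (auto simp: displacement_def)
  then show ?thesis using assms(2) by (metis add_diff_cancel_right torus_proj_eq_iff)
qed

lemma dist_le_displacement:
  assumes "displacement p q w"
  shows "dist p q \<le> norm w"
proof -
  obtain x where "torus_proj x = p" "torus_proj (x + w) = q"
    using assms by (auto simp: displacement_def)
  then show ?thesis using dist_torus_le[of x "x + w"] by simp
qed

lemma displacement_if_dist_less:
  assumes "dist p q < e"
  obtains w where "displacement p q w" "norm w < e"
proof -
  obtain x y where "torus_proj x = p" "torus_proj y = q" "norm (x - y) < e"
    using assms dist_torus_less_iff by blast
  then have "displacement p q (y - x)" "norm (y - x) < e"
    by (auto simp: displacement_def norm_minus_commute)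
  then show thesis by (rule that)
qed

lemma small_displacement_unique:
  assumes "displacement p q w" "displacement p q w'" "norm w + norm w' < 1"
  shows "w = w'"
proof -
  obtain x where x: "torus_proj x = p" using torus_proj_surj by blast
  then have "torus_proj (x + w) = torus_proj (x + w')"
    using assms(1,2) displacementD by metis
  then have "w - w' \<in> int_lattice" by (simp add: torus_proj_eq_iff)
  moreover have "norm (w - w') < 1" using norm_triangle_ineq4[of w w'] assms(3) by linarith
  ultimately show ?thesis using int_lattice_norm_lt_1 by fastforce
qed

lemma dist_eq_displacement:
  assumes "displacement p q w" "norm w \<le> 1 / 2"
  shows "dist p q = norm w"
proof (rule ccontr)
  assume "dist p q \<noteq> norm w"
  then have "dist p q < norm w" using dist_le_displacement[OF assms(1)] by linarith
  then obtain w' where "displacement p q w'" "norm w' < norm w" by (rule displacement_if_dist_less)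
  then show False using small_displacement_unique[OF assms(1), of w'] assms(2) by fastforce
qed

lemma torus_proj_bounded_representative:
  obtains x where "torus_proj x = (p :: T2)" "norm x \<le> 2"
proof -
  obtain y where y: "torus_proj y = p" using torus_proj_surj by blast
  define k :: "real^2" where "k = (\<chi> i. real_of_int \<lfloor>y $ i\<rfloor>)"
  have "k \<in> int_lattice"
    by (auto simp: int_lattice_def k_def Basis_vec_def inner_axis)
  then have "torus_proj (y - k) = p"
    using y by (metis int_lattice_minus minus_diff_eq add_uminus_conv_diff diff_add_cancel minus_diff_commute torus_proj_eq_iff uminus_add_conv_diff)
  moreover have "norm (y - k) \<le> 2"
  proof -
    have "\<bar>(y - k) $ i\<bar> \<le> 1" for i
      using floor_correct[of "y $ i"] by (simp add: k_def abs_le_iff) linarith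
    then have "(\<Sum>i\<in>UNIV. \<bar>(y - k) $ i\<bar>) \<le> (\<Sum>i\<in>(UNIV::2 set). 1)" by (intro sum_mono) blast
    then show ?thesis using norm_le_l1_cart[of "y - k"] by simp
  qed
  ultimately show thesis by (rule that)
qed

text \<open>Two lifts differ, after a lattice translation of the argument, by a map with values in the lattice. Where
both are differentiable this map is continuous, hence locally constant, and its derivative vanishes.\<close>

lemma torus_deriv_eq:
  assumes "is_lift G T" "(G has_derivative D) (at x)"
  shows "torus_deriv T (torus_proj x) = D"
  unfolding torus_deriv_def
proof (rule the_equality)
  show "\<exists>G y. is_lift G T \<and> torus_proj y = torus_proj x \<and> (G has_derivative D) (at y)"
    using assms by blast
next
  fix D' assume "\<exists>G y. is_lift G T \<and> torus_proj y = torus_proj x \<and> (G has_derivative D') (at y)"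
  then obtain G' y where G': "is_lift G' T" "torus_proj y = torus_proj x" "(G' has_derivative D') (at y)"
    by blast
  define k where "k = y - x"
  have k: "torus_proj (z + k) = torus_proj z" for z
    using G'(2) by (simp add: torus_proj_eq_iff k_def)
  define \<phi> where "\<phi> = (\<lambda>z. G' (z + k) - G z)"
  have lattice: "\<phi> z \<in> int_lattice" for z
    using assms(1) G'(1) k[of z] unfolding is_lift_def \<phi>_def by (metis torus_proj_eq_iff)
  have "((\<lambda>z. G' (z + k)) has_derivative D') (at x)"
  proof (rule has_derivative_compose[where f = "\<lambda>z. z + k" and f' = "\<lambda>h. h"])
    show "((\<lambda>z. z + k) has_derivative (\<lambda>h. h)) (at x)"
      by (auto intro!: derivative_eq_intros)
  qed (use G'(3) in \<open>simp add: k_def\<close>)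
  then have der: "(\<phi> has_derivative (\<lambda>h. D' h - D h)) (at x)"
    unfolding \<phi>_def using assms(2) by (rule has_derivative_diff)
  then have "isCont \<phi> x" by (rule has_derivative_continuous)
  then have "\<forall>\<^sub>F z in at x. dist (\<phi> z) (\<phi> x) < 1"
    by (simp add: isCont_def tendsto_iff)
  then have "\<forall>\<^sub>F z in at x. \<phi> z = \<phi> x"
  proof (rule eventually_mono)
    fix z assume "dist (\<phi> z) (\<phi> x) < 1"
    moreover have "\<phi> z - \<phi> x \<in> int_lattice"
      using int_lattice_add[OF lattice[of z] int_lattice_minus[OF lattice[of x]]] by simp
    ultimately show "\<phi> z = \<phi> x" using int_lattice_norm_lt_1 by (fastforce simp: dist_norm)
  qed
  then have "(\<phi> has_derivative (\<lambda>h. 0)) (at x)"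
    by (intro has_derivative_transform_eventually[OF has_derivative_const[of "\<phi> x"]])
      (auto elim: eventually_mono)
  then have "(\<lambda>h. D' h - D h) = (\<lambda>h. 0)" using der by (rule has_derivative_unique[rotated])
  then show "D' = D" by (metis eq_iff_diff_eq_0 ext)
qed

text \<open>One derivative is enough for the linearisation below, and the class is closed under composition.\<close>

definition C1_torus_map :: "(T2 \<Rightarrow> T2) \<Rightarrow> bool" where
  "C1_torus_map T \<longleftrightarrow> (\<exists>G G'. is_lift G T \<and>
     (\<forall>x. (G has_derivative blinfun_apply (G' x)) (at x)) \<and> continuous_on UNIV G')"

lemma C1_torus_mapE:
  assumes "C1_torus_map T"
  obtains G G' where "is_lift G T" "\<And>x. (G has_derivative blinfun_apply (G' x)) (at x)"
    "continuous_on UNIV G'" "\<And>x. torus_deriv T (torus_proj x) = blinfun_apply (G' x)"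
  using assms torus_deriv_eq unfolding C1_torus_map_def by metis

lemma C2_torus_map_imp_C1:
  assumes "C2_torus_map T"
  shows "C1_torus_map T"
proof -
  obtain G G' G'' where G: "is_lift G T" "\<forall>x. (G has_derivative blinfun_apply (G' x)) (at x)"
    "\<forall>x. (G' has_derivative blinfun_apply (G'' x)) (at x)"
    using assms unfolding C2_torus_map_def C2_map_def by blast
  then have "continuous_on UNIV G'"
    by (metis has_derivative_continuous continuous_at_imp_continuous_on)
  with G show ?thesis unfolding C1_torus_map_def by blast
qed

lemma C1_torus_map_id: "C1_torus_map id" and torus_deriv_id: "torus_deriv id p = id"
proof -
  have G: "is_lift id id" "(id has_derivative blinfun_apply id_blinfun) (at x)" for x
    by (simp_all add: is_lift_def id_def)
  then show "C1_torus_map id"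
    unfolding C1_torus_map_def by (intro exI[of _ id] exI[of _ "\<lambda>_. id_blinfun"]) auto
  obtain x where "torus_proj x = p" using torus_proj_surj by blast
  then show "torus_deriv id p = id" using torus_deriv_eq[OF G, of x] by (auto simp: fun_eq_iff)
qed

lemma C1_torus_map_comp:
  assumes "C1_torus_map S" "C1_torus_map T"
  shows "C1_torus_map (S \<circ> T)" "torus_deriv (S \<circ> T) p = torus_deriv S (T p) \<circ> torus_deriv T p"
proof -
  obtain G G' where G: "is_lift G S" "\<And>x. (G has_derivative blinfun_apply (G' x)) (at x)"
    "continuous_on UNIV G'" "\<And>x. torus_deriv S (torus_proj x) = blinfun_apply (G' x)"
    using C1_torus_mapE[OF assms(1)] by blast
  obtain H H' where H: "is_lift H T" "\<And>x. (H has_derivative blinfun_apply (H' x)) (at x)"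
    "continuous_on UNIV H'" "\<And>x. torus_deriv T (torus_proj x) = blinfun_apply (H' x)"
    using C1_torus_mapE[OF assms(2)] by blast
  have lift: "is_lift (G \<circ> H) (S \<circ> T)" using G(1) H(1) by (simp add: is_lift_def)
  have der: "((G \<circ> H) has_derivative blinfun_apply (G' (H x) o\<^sub>L H' x)) (at x)" for x
    using diff_chain_at[OF H(2) G(2), of x] by (simp add: comp_def blinfun_compose.rep_eq)
  have "continuous_on UNIV H"
    using H(2) by (metis has_derivative_continuous continuous_at_imp_continuous_on)
  then have "continuous_on UNIV (\<lambda>x. G' (H x))"
    using continuous_on_compose2[OF G(3)] by blast
  then have "continuous_on UNIV (\<lambda>x. G' (H x) o\<^sub>L H' x)"
    using H(3) by (intro continuous_intros)
  with lift der show "C1_torus_map (S \<circ> T)"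
    unfolding C1_torus_map_def by (intro exI[of _ "G \<circ> H"] exI[of _ "\<lambda>x. G' (H x) o\<^sub>L H' x"]) auto
  obtain x where x: "torus_proj x = p" using torus_proj_surj by blast
  then have "T p = torus_proj (H x)" using H(1) unfolding is_lift_def by metis
  then show "torus_deriv (S \<circ> T) p = torus_deriv S (T p) \<circ> torus_deriv T p"
    using torus_deriv_eq[OF lift der, of x] x G(4)[of "H x"] H(4)[of x] by (auto simp: fun_eq_iff)
qed

lemma C1_torus_map_funpow:
  assumes "C1_torus_map T"
  shows "C1_torus_map (T ^^ n)"
proof (induction n)
  case 0
  show ?case using C1_torus_map_id by (simp add: id_def)
next
  case (Suc n)
  show ?case using C1_torus_map_comp(1)[OF assms Suc] by (simp add: comp_def)
qed

lemma torus_deriv_funpow_Suc: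
  assumes "C1_torus_map T"
  shows "torus_deriv (T ^^ Suc n) p = torus_deriv T ((T ^^ n) p) \<circ> torus_deriv (T ^^ n) p"
  using C1_torus_map_comp(2)[OF assms C1_torus_map_funpow[OF assms]] by simp

lemma linear_torus_deriv:
  assumes "C1_torus_map T"
  shows "bounded_linear (torus_deriv T p)"
  using assms by (metis C1_torus_mapE blinfun.bounded_linear_right torus_proj_surj)

lemma torus_deriv_bounded:
  assumes "C1_torus_map T"
  obtains B where "0 < B" "\<And>p v. norm (torus_deriv T p v) \<le> B * norm v"
proof -
  obtain G G' where "is_lift G T" "\<And>x. (G has_derivative blinfun_apply (G' x)) (at x)"
    and G: "continuous_on UNIV G'" "\<And>x. torus_deriv T (torus_proj x) = blinfun_apply (G' x)"
    using C1_torus_mapE[OF assms] by blast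
  have "compact (G' ` cball 0 2)"
    using G(1) by (intro compact_continuous_image) (auto intro: continuous_on_subset)
  then obtain B where B: "0 < B" "\<And>x. x \<in> cball 0 2 \<Longrightarrow> norm (G' x) \<le> B"
    using compact_imp_bounded bounded_pos by (metis image_eqI)
  show thesis
  proof (rule that[OF B(1)])
    fix p :: T2 and v :: "real^2"
    obtain x where x: "torus_proj x = p" "norm x \<le> 2" by (rule torus_proj_bounded_representative)
    have "norm (blinfun_apply (G' x) v) \<le> norm (G' x) * norm v" by (rule norm_blinfun)
    also have "\<dots> \<le> B * norm v" using x(2) by (intro mult_right_mono B(2)) auto
    finally show "norm (torus_deriv T p v) \<le> B * norm v" using G(2)[of x] x(1) by simp
  qed
qed

text \<open>The derivative of a lift is uniformly continuous on a ball that contains a fundamental domain, and every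
torus point has a representative there; so the linearisation error is uniform over the torus.\<close>

lemma displacement_linearisation:
  assumes "C1_torus_map T" "0 < \<eta>"
  obtains \<epsilon> where "0 < \<epsilon>" "\<And>p q w. displacement p q w \<Longrightarrow> norm w < \<epsilon> \<Longrightarrow>
    \<exists>w'. displacement (T p) (T q) w' \<and> norm (w' - torus_deriv T p w) \<le> \<eta> * norm w"
proof -
  obtain G G' where G: "is_lift G T" "\<And>x. (G has_derivative blinfun_apply (G' x)) (at x)"
    "continuous_on UNIV G'" "\<And>x. torus_deriv T (torus_proj x) = blinfun_apply (G' x)"
    using C1_torus_mapE[OF assms(1)] by blast
  have "uniformly_continuous_on (cball 0 3) G'"
    using G(3) by (intro compact_uniformly_continuous) (auto intro: continuous_on_subset)
  then obtain \<delta> where \<delta>: "0 < \<delta>"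
    "\<And>x y. x \<in> cball 0 3 \<Longrightarrow> y \<in> cball 0 3 \<Longrightarrow> dist y x < \<delta> \<Longrightarrow> dist (G' y) (G' x) < \<eta>"
    using assms(2) unfolding uniformly_continuous_on_def by metis
  show thesis
  proof (rule that[of "min \<delta> 1"])
    fix p q w assume w: "displacement p q w" "norm w < min \<delta> 1"
    obtain x where x: "torus_proj x = p" "norm x \<le> 2" by (rule torus_proj_bounded_representative)
    have "norm (G (x + w) - G x - blinfun_apply (G' x) (x + w - x)) \<le> norm (x + w - x) * \<eta>"
    proof (rule differentiable_bound_linearization[of x "x + w" "ball x (min \<delta> 1)" G
          "\<lambda>y. blinfun_apply (G' y)" x])
      show "x + t *\<^sub>R (x + w - x) \<in> ball x (min \<delta> 1)" if "t \<in> {0..1}" for t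
      proof -
        have "norm (t *\<^sub>R w) \<le> norm w" using that by (simp add: mult_left_le_one_le)
        then show ?thesis using w(2) by (simp add: dist_norm)
      qed
      show "(G has_derivative blinfun_apply (G' y)) (at y within ball x (min \<delta> 1))" for y
        using G(2) by (rule has_derivative_at_withinI)
      show "onorm (blinfun_apply (G' y) - blinfun_apply (G' x)) \<le> \<eta>"
        if y: "y \<in> ball x (min \<delta> 1)" for y
      proof -
        have "norm y \<le> norm x + norm (x - y)"
          using norm_triangle_ineq4[of x "x - y"] by simp
        then have "y \<in> cball 0 3" using x(2) y by (simp add: dist_norm)
        then have "norm (G' y - G' x) \<le> \<eta>"
          using \<delta>(2)[of x y] x(2) y by (auto simp: dist_norm norm_minus_commute less_imp_le)
        then show ?thesis by (simp add: norm_blinfun.rep_eq minus_blinfun.rep_eq fun_diff_def)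
      qed
    qed (use \<delta>(1) in auto)
    then have "norm ((G (x + w) - G x) - torus_deriv T p w) \<le> \<eta> * norm w"
      using G(4)[of x] x(1) by (simp add: mult.commute)
    moreover have "displacement (T p) (T q) (G (x + w) - G x)"
    proof -
      have "torus_proj (G x) = T p" "torus_proj (G (x + w)) = T q"
        using G(1) x(1) displacementD[OF w(1) x(1)] by (auto simp: is_lift_def)
      then show ?thesis unfolding displacement_def by (metis add.commute diff_add_cancel)
    qed
    ultimately show "\<exists>w'. displacement (T p) (T q) w' \<and> norm (w' - torus_deriv T p w) \<le> \<eta> * norm w"
      by blast
  qed (use \<delta>(1) in auto)
qed

lemma C1_torus_map_lipschitz:
  assumes "C1_torus_map T"
  obtains B where "1 \<le> B" "\<And>p q. dist (T p) (T q) \<le> B * dist p q"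
proof -
  obtain G G' where G: "is_lift G T" "\<And>x. (G has_derivative blinfun_apply (G' x)) (at x)"
    "continuous_on UNIV G'" "\<And>x. torus_deriv T (torus_proj x) = blinfun_apply (G' x)"
    using C1_torus_mapE[OF assms] by blast
  obtain B where B: "0 < B" "\<And>p v. norm (torus_deriv T p v) \<le> B * norm v"
    using torus_deriv_bounded[OF assms] by blast
  have lip: "norm (G y - G x) \<le> B * norm (y - x)" for x y
  proof (rule differentiable_bound[where S = UNIV and f' = "\<lambda>x. blinfun_apply (G' x)"])
    show "onorm (blinfun_apply (G' z)) \<le> B" for z
      using B(2)[of "torus_proj z"] G(4)[of z] by (intro onorm_le) simp
  qed (use G(2) in auto)
  have "dist (T p) (T q) \<le> max 1 B * dist p q" for p q
  proof (rule field_le_epsilon)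
    fix e :: real assume "0 < e"
    then have "dist p q < dist p q + e / max 1 B" by simp
    then obtain w where w: "displacement p q w" "norm w < dist p q + e / max 1 B"
      by (rule displacement_if_dist_less)
    obtain x where x: "torus_proj x = p" "torus_proj (x + w) = q"
      using w(1) by (auto simp: displacement_def)
    then have "T p = torus_proj (G x)" "T q = torus_proj (G (x + w))"
      using G(1) unfolding is_lift_def by metis+
    then have "dist (T p) (T q) \<le> norm (G x - G (x + w))" using dist_torus_le by simp
    also have "\<dots> \<le> B * norm w" using lip[of "x + w" x] by (simp add: norm_minus_commute)
    also have "\<dots> \<le> max 1 B * (dist p q + e / max 1 B)"
      using w(2) B(1) by (intro mult_mono) auto
    also have "\<dots> = max 1 B * dist p q + e" by (simp add: distrib_left)
    finally show "dist (T p) (T q) \<le> max 1 B * dist p q + e" .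
  qed
  then show thesis by (intro that[of "max 1 B"]) auto
qed

section \<open>Hyperbolic splittings\<close>

locale hyperbolic_splitting =
  fixes S :: "T2 \<Rightarrow> T2" and Es Eu :: "T2 \<Rightarrow> (real^2) set" and c \<mu> :: real
  assumes bij: "bij S" and C1: "C1_torus_map S" "C1_torus_map (inv S)"
    and subspaces: "subspace (Es \<theta>)" "subspace (Eu \<theta>)"
    and disjoint: "Es \<theta> \<inter> Eu \<theta> = {0}"
    and spanning: "\<exists>a\<in>Es \<theta>. \<exists>b\<in>Eu \<theta>. v = a + b"
    and invariant: "torus_deriv S \<theta> ` Es \<theta> = Es (S \<theta>)" "torus_deriv S \<theta> ` Eu \<theta> = Eu (S \<theta>)"
    and rate: "0 < c" "0 < \<mu>" "\<mu> < 1"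
    and contract: "v \<in> Es \<theta> \<Longrightarrow> norm (torus_deriv (S ^^ n) \<theta> v) \<le> c * \<mu> ^ n * norm v"
      "v \<in> Eu \<theta> \<Longrightarrow> norm (torus_deriv (inv S ^^ n) \<theta> v) \<le> c * \<mu> ^ n * norm v"

lemma hyperbolic_splitting_if_anosov:
  assumes "C2_anosov_diffeo S"
  obtains Es Eu c \<mu> where "hyperbolic_splitting S Es Eu c \<mu>"
proof -
  have bij: "bij S" and C1: "C1_torus_map S" "C1_torus_map (inv S)"
    using assms C2_torus_map_imp_C1 by (auto simp: C2_anosov_diffeo_def C2_torus_diffeo_def)
  obtain Es Eu where E: "anosov_splitting S Es Eu"
    using assms by (auto simp: C2_anosov_diffeo_def)
  then obtain c \<mu> where c: "0 < c" "0 < \<mu>" "\<mu> < 1" "\<forall>\<theta> n.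
        (\<forall>v\<in>Es \<theta>. norm (torus_deriv (S ^^ n) \<theta> v) \<le> c * \<mu> ^ n * norm v) \<and>
        (\<forall>v\<in>Eu \<theta>. norm (torus_deriv (inv S ^^ n) \<theta> v) \<le> c * \<mu> ^ n * norm v)"
    unfolding anosov_splitting_def by blast
  have E1: "\<forall>\<theta>. subspace (Es \<theta>) \<and> subspace (Eu \<theta>) \<and> Es \<theta> \<inter> Eu \<theta> = {0} \<and>
          {a + b | a b. a \<in> Es \<theta> \<and> b \<in> Eu \<theta>} = UNIV"
    and E2: "\<forall>\<theta>. torus_deriv S \<theta> ` Es \<theta> = Es (S \<theta>) \<and> torus_deriv S \<theta> ` Eu \<theta> = Eu (S \<theta>)"
    using E unfolding anosov_splitting_def by blast+
  have "\<exists>a\<in>Es \<theta>. \<exists>b\<in>Eu \<theta>. v = a + b" for \<theta> v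
  proof -
    have "v \<in> {a + b | a b. a \<in> Es \<theta> \<and> b \<in> Eu \<theta>}" using E1 by simp
    then show ?thesis by blast
  qed
  then have "hyperbolic_splitting S Es Eu c \<mu>"
    using bij C1 E1 E2 c by (simp add: hyperbolic_splitting_def)
  then show thesis by (rule that)
qed

context hyperbolic_splitting
begin

lemma funpow_inv_cancel: "(inv S ^^ n) ((S ^^ n) \<theta>) = \<theta>" "(S ^^ n) ((inv S ^^ n) \<theta>) = \<theta>"
  using bij_fn[OF bij, of n] inv_fn[OF bij, of n]
  by (metis bij_is_inj inv_f_f, metis bij_is_surj surj_f_inv_f)

lemma deriv_inverse:
  "torus_deriv (inv S ^^ n) ((S ^^ n) \<theta>) (torus_deriv (S ^^ n) \<theta> v) = v"
  "torus_deriv (S ^^ n) ((inv S ^^ n) \<theta>) (torus_deriv (inv S ^^ n) \<theta> v) = v"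
proof -
  have "(inv S ^^ n) \<circ> (S ^^ n) = id" "(S ^^ n) \<circ> (inv S ^^ n) = id"
    by (auto simp: funpow_inv_cancel)
  then show "torus_deriv (inv S ^^ n) ((S ^^ n) \<theta>) (torus_deriv (S ^^ n) \<theta> v) = v"
    "torus_deriv (S ^^ n) ((inv S ^^ n) \<theta>) (torus_deriv (inv S ^^ n) \<theta> v) = v"
    using C1_torus_map_comp(2)[OF C1_torus_map_funpow[OF C1(2)] C1_torus_map_funpow[OF C1(1)], of n n \<theta>]
      C1_torus_map_comp(2)[OF C1_torus_map_funpow[OF C1(1)] C1_torus_map_funpow[OF C1(2)], of n n \<theta>]
      torus_deriv_id[of \<theta>] by (metis comp_apply id_apply)+
qed

lemma funpow_invariant:
  "torus_deriv (S ^^ n) \<theta> ` Es \<theta> = Es ((S ^^ n) \<theta>)"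
  "torus_deriv (S ^^ n) \<theta> ` Eu \<theta> = Eu ((S ^^ n) \<theta>)"
proof (induction n)
  case 0
  {
    case 1
    show ?case using torus_deriv_id[of \<theta>] by (simp add: id_def)
  next
    case 2
    show ?case using torus_deriv_id[of \<theta>] by (simp add: id_def)
  }
next
  case (Suc n)
  {
    case 1
    show ?case unfolding torus_deriv_funpow_Suc[OF C1(1)] image_comp[symmetric] Suc
      using invariant by simp
  next
    case 2
    show ?case unfolding torus_deriv_funpow_Suc[OF C1(1)] image_comp[symmetric] Suc
      using invariant by simp
  }
qed

text \<open>Backward contraction of \<open>Eu\<close> read forwards.\<close>

lemma expand:
  assumes "v \<in> Eu \<theta>"
  shows "norm v \<le> c * \<mu> ^ n * norm (torus_deriv (S ^^ n) \<theta> v)"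
proof -
  have "torus_deriv (S ^^ n) \<theta> v \<in> Eu ((S ^^ n) \<theta>)"
    using assms funpow_invariant(2) by blast
  from contract(2)[OF this, of n] show ?thesis by (simp add: deriv_inverse)
qed

text \<open>Every fact about \<open>S\<close> and \<open>Es\<close> thereby holds for \<open>inv S\<close> and \<open>Eu\<close> as well, so each is
  proved once.\<close>

lemma inverse_splitting: "hyperbolic_splitting (inv S) Eu Es c \<mu>"
proof
  have flip: "torus_deriv (inv S) \<theta> ` E \<theta> = E (inv S \<theta>)"
    if "\<And>\<theta>. torus_deriv S \<theta> ` E \<theta> = E (S \<theta>)" for E \<theta>
  proof -
    have "E \<theta> = torus_deriv S (inv S \<theta>) ` E (inv S \<theta>)"
      using that[of "inv S \<theta>"] bij by (simp add: bij_is_surj surj_f_inv_f)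
    then have "torus_deriv (inv S) \<theta> ` E \<theta> =
        (\<lambda>v. torus_deriv (inv S) (S (inv S \<theta>)) (torus_deriv S (inv S \<theta>) v)) ` E (inv S \<theta>)"
      using bij by (simp add: bij_is_surj surj_f_inv_f image_image)
    then show ?thesis using deriv_inverse(1)[of 1 "inv S \<theta>"] by simp
  qed
  show "torus_deriv (inv S) \<theta> ` Eu \<theta> = Eu (inv S \<theta>)" "torus_deriv (inv S) \<theta> ` Es \<theta> = Es (inv S \<theta>)" for \<theta>
    using flip invariant by blast+
  show "\<exists>a\<in>Eu \<theta>. \<exists>b\<in>Es \<theta>. v = a + b" for \<theta> v
    using spanning[of \<theta> v] by (metis add.commute)
qed (use bij C1 subspaces disjoint rate contract in
    \<open>auto simp: inv_inv_eq bij_imp_bij_inv Int_commute\<close>)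

lemma linear_deriv: "linear (torus_deriv (S ^^ n) \<theta>)"
  by (rule bounded_linear.linear[OF linear_torus_deriv[OF C1_torus_map_funpow[OF C1(1)]]])

lemma decomposition_unique:
  assumes "a \<in> Es \<theta>" "b \<in> Eu \<theta>" "a' \<in> Es \<theta>" "b' \<in> Eu \<theta>" "a + b = a' + b'"
  shows "a = a'" "b = b'"
proof -
  have "a - a' \<in> Es \<theta>" "b' - b \<in> Eu \<theta>"
    using assms subspaces by (simp_all add: subspace_diff)
  moreover have "a - a' = b' - b" using assms(5) by (simp add: algebra_simps)
  ultimately have "a - a' \<in> Es \<theta> \<inter> Eu \<theta>" by simp
  then show "a = a'" by (simp add: disjoint)
  then show "b = b'" using assms(5) by simp
qed

lemma geometric_small:
  assumes "0 < (e::real)"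
  obtains N where "c * \<mu> ^ N \<le> e"
proof -
  have "(\<lambda>n. c * \<mu> ^ n) \<longlonglongrightarrow> 0"
    using rate by (intro tendsto_mult_right_zero LIMSEQ_realpow_zero) auto
  then have "\<forall>\<^sub>F n in sequentially. c * \<mu> ^ n < e" using assms by (rule order_tendstoD)
  then obtain N where "\<forall>n\<ge>N. c * \<mu> ^ n < e" by (auto simp: eventually_sequentially)
  then show thesis by (intro that[of N]) (simp add: less_imp_le)
qed

text \<open>If \<open>a + b\<close> were much shorter than \<open>b\<close>, then \<open>S ^^ N\<close>, whose derivative is bounded, would keep it short. But
\<open>a\<close> would be about as long as \<open>b\<close>, and for large \<open>N\<close> the image of \<open>b\<close> is at least doubled while that of \<open>a\<close> is at
least halved. This gives a uniform angle with no continuity of the splitting.\<close>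

lemma bounded_angle:
  obtains P where "0 < P" "\<And>\<theta> a b. a \<in> Es \<theta> \<Longrightarrow> b \<in> Eu \<theta> \<Longrightarrow> norm a \<le> P * norm (a + b)"
    "\<And>\<theta> a b. a \<in> Es \<theta> \<Longrightarrow> b \<in> Eu \<theta> \<Longrightarrow> norm b \<le> P * norm (a + b)"
proof -
  obtain N where N: "c * \<mu> ^ N \<le> 1 / 2" by (rule geometric_small[of "1/2"]) auto
  obtain B where B: "0 < B" "\<And>p v. norm (torus_deriv (S ^^ N) p v) \<le> B * norm v"
    using torus_deriv_bounded[OF C1_torus_map_funpow[OF C1(1)]] by blast
  have b: "norm b \<le> (B + 1) * norm (a + b)" if "a \<in> Es \<theta>" "b \<in> Eu \<theta>" for a b \<theta>
  proof -
    let ?A = "torus_deriv (S ^^ N) \<theta>"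
    have "norm (?A a) \<le> (1/2) * norm a" "norm b \<le> (1/2) * norm (?A b)"
      using contract(1)[OF that(1), of N] expand[OF that(2), of N] mult_right_mono[OF N norm_ge_zero[of a]]
        mult_right_mono[OF N norm_ge_zero[of "?A b"]] by linarith+
    moreover have "norm (?A b) \<le> norm (?A (a + b)) + norm (?A a)"
      using norm_triangle_ineq4[of "?A (a + b)" "?A a"] linear_add[OF linear_deriv] by simp
    moreover have "norm a \<le> norm (a + b) + norm b" using norm_triangle_ineq4[of "a + b" b] by simp
    moreover have "norm (?A (a + b)) \<le> B * norm (a + b)" by (rule B(2))
    moreover have "0 \<le> B * norm (a + b)" using B(1) by simp
    moreover have "(B + 1) * norm (a + b) = B * norm (a + b) + norm (a + b)"
      by (simp add: distrib_right)
    ultimately show ?thesis using norm_ge_zero[of "a + b"] by linarith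
  qed
  show thesis
  proof (rule that[of "B + 2"])
    fix \<theta> a b assume ab: "a \<in> Es \<theta>" "b \<in> Eu \<theta>"
    note b[OF ab]
    moreover have "norm a \<le> norm (a + b) + norm b" using norm_triangle_ineq4[of "a + b" b] by simp
    moreover have "(B + 2) * norm (a + b) = (B + 1) * norm (a + b) + norm (a + b)"
      by (simp add: distrib_right)
    ultimately show "norm a \<le> (B + 2) * norm (a + b)" "norm b \<le> (B + 2) * norm (a + b)"
      using norm_ge_zero[of "a + b"] by linarith+
  qed (use B(1) in auto)
qed

text \<open>A nonzero \<open>Eu\<close>-component would grow exponentially.\<close>

lemma bounded_orbit_imp_Es:
  assumes bd: "\<And>n. norm (torus_deriv (S ^^ n) \<theta> v) \<le> K"
  shows "v \<in> Es \<theta>"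
proof -
  obtain a b where ab: "a \<in> Es \<theta>" "b \<in> Eu \<theta>" "v = a + b" using spanning by blast
  have "norm b \<le> (c * \<mu> ^ n) * (K + c * norm a)" for n
  proof -
    let ?A = "torus_deriv (S ^^ n) \<theta>"
    have "norm (?A b) \<le> norm (?A v) + norm (?A a)"
      using norm_triangle_ineq4[of "?A v" "?A a"] linear_add[OF linear_deriv] ab(3) by simp
    also have "norm (?A a) \<le> c * norm a"
    proof -
      have "c * \<mu> ^ n * norm a \<le> c * 1 * norm a"
        using rate by (intro mult_right_mono mult_left_mono power_le_one) auto
      then show ?thesis using contract(1)[OF ab(1), of n] by linarith
    qed
    also have "norm (?A v) \<le> K" by (rule bd)
    finally have "norm (?A b) \<le> K + c * norm a" by simp
    then show ?thesis
      using expand[OF ab(2), of n] rate mult_left_mono[of "norm (?A b)" "K + c * norm a" "c * \<mu> ^ n"]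
      by (auto intro: order_trans)
  qed
  moreover have "(\<lambda>n. (c * \<mu> ^ n) * (K + c * norm a)) \<longlonglongrightarrow> 0"
    using rate by (intro tendsto_mult_left_zero tendsto_mult_right_zero LIMSEQ_realpow_zero) auto
  ultimately have "norm b \<le> 0" by (intro LIMSEQ_le_const) auto
  then show ?thesis using ab by simp
qed

text \<open>Split the displacement between the two orbits along \<open>Es\<close> and \<open>Eu\<close>, and observe it every \<open>N\<close> steps, with \<open>N\<close> so large
that the constants \<open>c\<close> and \<open>K\<close> are absorbed. If the \<open>Eu\<close>-part ever exceeds the \<open>Es\<close>-part it does so forever
and grows by the factor \<open>3 / 2\<close>, contrary to boundedness. So the \<open>Es\<close>-part dominates, and it shrinks
by \<open>\<rho> ^ N\<close> in \<open>N\<close> steps: half of this comes from the linear map, half from the error of the linearisation.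

The \<open>Es\<close>-vector \<open>a\<close> is kept in the conclusion because it is \<open>0\<close> when \<open>Es\<close> is trivial; two asymptotic
orbits then coincide.\<close>

lemma asymptotic_imp_exponential:
  assumes \<kappa>: "0 \<le> \<kappa>" "\<kappa> < \<rho>" "\<rho> < 1"
    and contr: "\<And>\<theta> v n. v \<in> Es \<theta> \<Longrightarrow> norm (torus_deriv (S ^^ n) \<theta> v) \<le> K * \<kappa> ^ n * norm v"
    and asym: "(\<lambda>n. dist ((S ^^ n) p) ((S ^^ n) q)) \<longlonglongrightarrow> 0"
  obtains n0 D a where "a \<in> Es ((S ^^ n0) p)"
    "\<And>n. n0 \<le> n \<Longrightarrow> dist ((S ^^ n) p) ((S ^^ n) q) \<le> D * \<rho> ^ n * norm a"
proof -
  have \<rho>: "0 < \<rho>" using \<kappa> by linarith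
  obtain N where N: "0 < N" "c * \<mu> ^ N \<le> 1 / 2" "K * \<kappa> ^ N \<le> \<rho> ^ N / 2"
  proof -
    have "(\<lambda>n. c * \<mu> ^ n) \<longlonglongrightarrow> 0" "(\<lambda>n. K * (\<kappa> / \<rho>) ^ n) \<longlonglongrightarrow> 0"
      using rate \<kappa> \<rho> by (auto intro!: tendsto_mult_right_zero LIMSEQ_realpow_zero)
    then have "\<forall>\<^sub>F n in sequentially. c * \<mu> ^ n < 1 / 2" "\<forall>\<^sub>F n in sequentially. K * (\<kappa> / \<rho>) ^ n < 1 / 2"
      by (auto dest: order_tendstoD(2)[where a = "1 / 2"])
    with eventually_gt_at_top[of 0]
    have "\<forall>\<^sub>F n in sequentially. 0 < n \<and> c * \<mu> ^ n < 1 / 2 \<and> K * (\<kappa> / \<rho>) ^ n < 1 / 2"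
      by (intro eventually_conj)
    from eventually_happens'[OF sequentially_bot this]
    obtain N where "0 < N" "c * \<mu> ^ N < 1 / 2" "K * (\<kappa> / \<rho>) ^ N < 1 / 2" by blast
    then show thesis using \<rho> by (intro that[of N]) (simp_all add: power_divide field_simps)
  qed
  obtain P where P: "0 < P" "\<And>\<theta> a b. a \<in> Es \<theta> \<Longrightarrow> b \<in> Eu \<theta> \<Longrightarrow> norm a \<le> P * norm (a + b)"
    "\<And>\<theta> a b. a \<in> Es \<theta> \<Longrightarrow> b \<in> Eu \<theta> \<Longrightarrow> norm b \<le> P * norm (a + b)"
    using bounded_angle by blast
  \<comment> \<open>Relative size of the linearisation error once it is split along \<open>Es\<close> and \<open>Eu\<close>, which costs the factor \<open>P\<close>.\<close>
  define \<delta> where "\<delta> = \<rho> ^ N / 4"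
  have \<delta>: "0 < \<delta>" "\<delta> \<le> 1 / 4" using \<rho> \<kappa>(3) by (simp_all add: \<delta>_def power_le_one)
  define \<eta> where "\<eta> = \<delta> / P"
  have \<eta>: "0 < \<eta>" "P * \<eta> = \<delta>" using \<delta>(1) P(1) by (simp_all add: \<eta>_def)
  define T where "T = S ^^ N"
  have T: "C1_torus_map T" unfolding T_def using C1(1) by (rule C1_torus_map_funpow)
  obtain \<epsilon> where \<epsilon>: "0 < \<epsilon>" "\<And>p q w. displacement p q w \<Longrightarrow> norm w < \<epsilon> \<Longrightarrow>
      \<exists>w'. displacement (T p) (T q) w' \<and> norm (w' - torus_deriv T p w) \<le> \<eta> * norm w"
    using displacement_linearisation[OF T \<eta>(1)] by blast
  obtain B where B: "0 < B" "\<And>p v. norm (torus_deriv T p v) \<le> B * norm v"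
    using torus_deriv_bounded[OF T] by blast
  define e where "e = min \<epsilon> (1 / (B + \<eta> + 1))"
  have e: "0 < e" "e \<le> \<epsilon>" "(B + \<eta>) * e + e \<le> 1"
  proof -
    show "0 < e" "e \<le> \<epsilon>" using \<epsilon>(1) B(1) \<eta>(1) by (simp_all add: e_def)
    have "(B + \<eta> + 1) * e \<le> (B + \<eta> + 1) * (1 / (B + \<eta> + 1))"
      using B(1) \<eta>(1) by (intro mult_left_mono) (auto simp: e_def)
    then show "(B + \<eta>) * e + e \<le> 1" using B(1) \<eta>(1) by (simp add: algebra_simps)
  qed
  obtain n0 where n0: "\<And>n. n0 \<le> n \<Longrightarrow> dist ((S ^^ n) p) ((S ^^ n) q) < e"
    using order_tendstoD(2)[OF asym e(1)] by (auto simp: eventually_sequentially)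
  define x y where "x = (\<lambda>k. (S ^^ (n0 + N * k)) p)" and "y = (\<lambda>k. (S ^^ (n0 + N * k)) q)"
  have Suc: "x (Suc k) = T (x k)" "y (Suc k) = T (y k)" for k
  proof -
    have "n0 + N * Suc k = N + (n0 + N * k)" by simp
    then show "x (Suc k) = T (x k)" "y (Suc k) = T (y k)"
      unfolding x_def y_def T_def by (simp_all only: funpow_add comp_apply)
  qed
  have "\<exists>w. displacement (x k) (y k) w \<and> norm w < e" for k
    using displacement_if_dist_less[OF n0[of "n0 + N * k"]] unfolding x_def y_def by (metis le_add1)
  then obtain v where v: "\<And>k. displacement (x k) (y k) (v k)" "\<And>k. norm (v k) < e"
    by metis
  have "\<exists>a b. a \<in> Es (x k) \<and> b \<in> Eu (x k) \<and> v k = a + b" for k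
    using spanning[of "x k" "v k"] by blast
  then obtain a b where ab: "\<And>k. a k \<in> Es (x k)" "\<And>k. b k \<in> Eu (x k)" "\<And>k. v k = a k + b k"
    by metis
  have step: "norm (a (Suc k)) \<le> \<rho> ^ N / 2 * norm (a k) + \<delta> * norm (v k)"
    "2 * norm (b k) - \<delta> * norm (v k) \<le> norm (b (Suc k))" for k
  proof -
    let ?A = "torus_deriv T (x k)"
    obtain w where w: "displacement (T (x k)) (T (y k)) w" "norm (w - ?A (v k)) \<le> \<eta> * norm (v k)"
      using \<epsilon>(2)[OF v(1)] v(2)[of k] e(2) by force
    \<comment> \<open>The image displacement \<open>w\<close> and \<open>v (Suc k)\<close> are both short, so they differ by no lattice vector.\<close>
    have "norm w \<le> norm (?A (v k)) + norm (w - ?A (v k))" by (metis norm_triangle_sub)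
    also have "\<dots> \<le> (B + \<eta>) * norm (v k)"
      using w(2) B(2)[of "x k" "v k"] by (simp add: distrib_right)
    also have "\<dots> \<le> (B + \<eta>) * e" using v(2)[of k] B(1) \<eta>(1) by (intro mult_left_mono) auto
    finally have "norm w + norm (v (Suc k)) < 1" using v(2)[of "Suc k"] e(3) by linarith
    then have w_eq: "v (Suc k) = w"
      using small_displacement_unique[OF w(1), of "v (Suc k)"] v(1)[of "Suc k"] Suc by simp
    obtain a' b' where r: "a' \<in> Es (x (Suc k))" "b' \<in> Eu (x (Suc k))" "w - ?A (v k) = a' + b'"
      using spanning by blast
    have "P * norm (a' + b') \<le> P * (\<eta> * norm (v k))"
      using w(2) P(1) unfolding r(3)[symmetric] by (intro mult_left_mono) auto
    then have r': "norm a' \<le> \<delta> * norm (v k)" "norm b' \<le> \<delta> * norm (v k)"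
      using P(2)[OF r(1,2)] P(3)[OF r(1,2)] \<eta>(2) by (simp_all flip: mult.assoc)
    have A: "?A (a k) \<in> Es (x (Suc k))" "?A (b k) \<in> Eu (x (Suc k))"
      using ab(1,2) funpow_invariant[of N "x k"] unfolding Suc T_def by blast+
    have "v (Suc k) = (?A (a k) + a') + (?A (b k) + b')"
      using r(3) w_eq ab(3)[of k] linear_add[OF linear_deriv, of N "x k"] by (simp add: T_def algebra_simps)
    then have "a (Suc k) + b (Suc k) = (?A (a k) + a') + (?A (b k) + b')"
      using ab(3)[of "Suc k"] by simp
    note eq = decomposition_unique[OF ab(1)[of "Suc k"] ab(2)[of "Suc k"]
        subspace_add[OF subspaces(1) A(1) r(1)] subspace_add[OF subspaces(2) A(2) r(2)] this]
    have "norm (?A (a k)) \<le> \<rho> ^ N / 2 * norm (a k)"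
      using contr[OF ab(1), of N k] mult_right_mono[OF N(3) norm_ge_zero[of "a k"]]
      unfolding T_def by linarith
    then show "norm (a (Suc k)) \<le> \<rho> ^ N / 2 * norm (a k) + \<delta> * norm (v k)"
      using norm_triangle_ineq[of "?A (a k)" a'] r'(1) unfolding eq by linarith
    have "norm (b k) \<le> 1 / 2 * norm (?A (b k))"
      using expand[OF ab(2), of k N] mult_right_mono[OF N(2) norm_ge_zero[of "?A (b k)"]]
      unfolding T_def by linarith
    then show "2 * norm (b k) - \<delta> * norm (v k) \<le> norm (b (Suc k))"
      using norm_diff_ineq[of "?A (b k)" b'] r'(2) unfolding eq by linarith
  qed
  have vab: "\<delta> * norm (v k) \<le> \<delta> * (norm (a k) + norm (b k))" for k
    using norm_triangle_ineq[of "a k" "b k"] ab(3)[of k] \<delta>(1) by simp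
  have cone: "norm (b k) \<le> norm (a k)" for k
  proof (rule ccontr)
    assume "\<not> norm (b k) \<le> norm (a k)"
    then have k: "norm (a k) < norm (b k)" by simp
    have grow: "norm (a (k + j)) < norm (b (k + j)) \<and> (3 / 2) ^ j * norm (b k) \<le> norm (b (k + j))" for j
    proof (induction j)
      case (Suc j)
      note IH = conjunct1[OF Suc] conjunct2[OF Suc]
      let ?a = "norm (a (k + j))" and ?b = "norm (b (k + j))"
      have "\<delta> * (?a + ?b) \<le> 1 / 4 * (?a + ?b)" using \<delta>(2) by (intro mult_right_mono) auto
      then have "\<delta> * norm (v (k + j)) \<le> 1 / 4 * (?a + ?b)" using vab[of "k + j"] by (rule order_trans[rotated])
      then have s: "\<delta> * norm (v (k + j)) \<le> 1 / 2 * ?b" using IH(1) by argo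
      have "\<rho> ^ N / 2 * ?a \<le> 1 / 2 * ?a" using \<rho> \<kappa>(3) by (intro mult_right_mono) (auto simp: power_le_one)
      then have "norm (a (Suc (k + j))) \<le> ?b" "3 / 2 * ?b \<le> norm (b (Suc (k + j)))"
        using s step[of "k + j"] IH by linarith+
      moreover have "0 < ?b" using IH(1) norm_ge_zero[of "a (k + j)"] by linarith
      ultimately have "norm (a (Suc (k + j))) < norm (b (Suc (k + j)))" by linarith
      moreover have "(3 / 2) ^ Suc j * norm (b k) \<le> 3 / 2 * ?b"
        using mult_left_mono[OF IH(2), of "3 / 2"] by (simp add: mult.assoc)
      ultimately show ?case using \<open>3 / 2 * ?b \<le> _\<close> unfolding add_Suc_right by (intro conjI; linarith)
    qed (use k in simp)
    have "norm (b (k + j)) \<le> P * e" for j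
      using P(3)[OF ab(1)[of "k + j"] ab(2)[of "k + j"]] v(2)[of "k + j"] P(1) mult_left_mono[of "norm (v (k + j))" e P]
      unfolding ab(3)[symmetric] by linarith
    then have "(3 / 2) ^ j * norm (b k) \<le> P * e" for j using grow[of j] by (meson order_trans)
    moreover have "0 < norm (b k)" using k norm_ge_zero[of "a k"] by linarith
    moreover obtain j where "P * e / norm (b k) < (3 / 2) ^ j" using real_arch_pow[of "3/2"] by auto
    ultimately show False by (metis divide_less_eq not_le)
  qed
  have decay: "norm (a k) \<le> \<rho> ^ (N * k) * norm (a 0)" for k
  proof (induction k)
    case (Suc k)
    have "\<delta> * norm (v k) \<le> \<rho> ^ N / 2 * norm (a k)"
      using vab[of k] mult_left_mono[of "norm (a k) + norm (b k)" "2 * norm (a k)" \<delta>] cone[of k] \<delta>(1)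
      by (simp add: \<delta>_def)
    then have "norm (a (Suc k)) \<le> \<rho> ^ N * norm (a k)" using step(1)[of k] by linarith
    also have "\<dots> \<le> \<rho> ^ N * (\<rho> ^ (N * k) * norm (a 0))" using Suc \<rho> by (intro mult_left_mono) auto
    finally show ?case by (simp add: power_add mult.assoc)
  qed simp
  obtain L where L: "1 \<le> L" "\<And>p q. dist (S p) (S q) \<le> L * dist p q"
    using C1_torus_map_lipschitz[OF C1(1)] by blast
  have Ln: "dist ((S ^^ i) p) ((S ^^ i) q) \<le> L ^ i * dist p q" for i p q
  proof (induction i)
    case (Suc i)
    have "dist ((S ^^ Suc i) p) ((S ^^ Suc i) q) \<le> L * dist ((S ^^ i) p) ((S ^^ i) q)" using L(2) by simp
    also have "\<dots> \<le> L * (L ^ i * dist p q)" using Suc L(1) by (intro mult_left_mono) auto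
    finally show ?case by simp
  qed simp
  have "dist ((S ^^ n) p) ((S ^^ n) q) \<le> (2 * L ^ N / \<rho> ^ (n0 + N)) * \<rho> ^ n * norm (a 0)" if "n0 \<le> n" for n
  proof -
    define k i where "k = (n - n0) div N" and "i = (n - n0) mod N"
    have n: "n = i + (n0 + N * k)" "i < N" using that N(1) by (simp_all add: k_def i_def)
    have "dist ((S ^^ n) p) ((S ^^ n) q) = dist ((S ^^ i) (x k)) ((S ^^ i) (y k))"
      unfolding n(1) x_def y_def by (simp only: funpow_add comp_apply)
    also have "\<dots> \<le> L ^ i * dist (x k) (y k)" by (rule Ln)
    also have "\<dots> \<le> L ^ N * (2 * (\<rho> ^ (N * k) * norm (a 0)))"
    proof (rule mult_mono)
      show "L ^ i \<le> L ^ N" using n(2) L(1) by (intro power_increasing) auto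
      have "norm (v k) \<le> 2 * norm (a k)"
        using norm_triangle_ineq[of "a k" "b k"] cone[of k] ab(3)[of k] by simp
      then show "dist (x k) (y k) \<le> 2 * (\<rho> ^ (N * k) * norm (a 0))"
        using dist_le_displacement[OF v(1), of k] decay[of k] by linarith
    qed (use L(1) in auto)
    also have "\<rho> ^ (N * k) \<le> \<rho> ^ n / \<rho> ^ (n0 + N)"
    proof -
      have "\<rho> ^ (N * k) * \<rho> ^ (n0 + N) = \<rho> ^ (N * k + (n0 + N))" by (simp add: power_add)
      also have "\<dots> \<le> \<rho> ^ n" using n \<rho> \<kappa>(3) by (intro power_decreasing) auto
      finally show ?thesis using \<rho> by (simp add: pos_le_divide_eq)
    qed
    finally show ?thesis using L(1) by (simp add: mult_left_mono mult_right_mono mult_ac)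
  qed
  moreover have "a 0 \<in> Es ((S ^^ n0) p)" using ab(1)[of 0] by (simp add: x_def)
  ultimately show thesis by (rule that[rotated])
qed

end

section \<open>Tangent directions of local stable fibres\<close>

text \<open>The unit vectors pointing from \<open>p\<close> to the points \<open>q\<close> accumulate at some \<open>e\<close>. For fixed \<open>n\<close> the map \<open>T ^^ n\<close> acts on
the shortest secants like its derivative, so the contraction of distances passes to \<open>e\<close>.\<close>

lemma secant_limit:
  assumes T: "C1_torus_map T" and C: "0 \<le> C" "0 \<le> \<alpha>"
    and near: "\<And>\<delta>. 0 < \<delta> \<Longrightarrow> \<exists>q. q \<noteq> p \<and> dist p q < \<delta> \<and>
      (\<forall>n. dist ((T ^^ n) p) ((T ^^ n) q) \<le> C * \<alpha> ^ n * dist p q)"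
  obtains e where "norm e = 1" "\<And>n. norm (torus_deriv (T ^^ n) p e) \<le> C * \<alpha> ^ n"
proof -
  have "\<exists>q w. q \<noteq> p \<and> displacement p q w \<and> norm w < inverse (real (Suc i)) \<and>
      (\<forall>n. dist ((T ^^ n) p) ((T ^^ n) q) \<le> C * \<alpha> ^ n * dist p q)" for i
    using near[of "inverse (real (Suc i))"] displacement_if_dist_less by (metis inverse_positive_iff_positive of_nat_0_less_iff zero_less_Suc)
  then obtain q w where qw: "\<And>i. q i \<noteq> p" "\<And>i. displacement p (q i) (w i)"
    "\<And>i. norm (w i) < inverse (real (Suc i))"
    "\<And>i n. dist ((T ^^ n) p) ((T ^^ n) (q i)) \<le> C * \<alpha> ^ n * dist p (q i)"
    by metis
  have w0: "0 < norm (w i)" for i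
    using dist_le_displacement[OF qw(2)[of i]] qw(1)[of i] by (metis dist_pos_lt less_le_trans)
  have small: "\<forall>\<^sub>F i in sequentially. norm (w i) < e" if "0 < e" for e
  proof -
    have "\<forall>\<^sub>F i in sequentially. inverse (real (Suc i)) < e"
      using LIMSEQ_inverse_real_of_nat that by (rule order_tendstoD(2))
    then show ?thesis by (rule eventually_mono) (use qw(3) in \<open>meson less_trans\<close>)
  qed
  define u where "u = (\<lambda>i. w i /\<^sub>R norm (w i))"
  have "\<forall>i. u i \<in> sphere 0 1" using w0 by (auto simp: u_def)
  then obtain e r where e: "e \<in> sphere 0 1" and r: "strict_mono r" and lim: "(u \<circ> r) \<longlonglongrightarrow> e"
    using seq_compactE[OF compact_imp_seq_compact[OF compact_sphere[of "0::real^2" 1]], of u] by blast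
  have "norm (torus_deriv (T ^^ n) p e) \<le> C * \<alpha> ^ n" for n
  proof (rule field_le_epsilon)
    fix \<eta> :: real assume \<eta>: "0 < \<eta>"
    let ?A = "torus_deriv (T ^^ n) p"
    have Tn: "C1_torus_map (T ^^ n)" using T by (rule C1_torus_map_funpow)
    have lin: "bounded_linear ?A" using Tn by (rule linear_torus_deriv)
    obtain \<epsilon> where \<epsilon>: "0 < \<epsilon>" "\<And>p q w. displacement p q w \<Longrightarrow> norm w < \<epsilon> \<Longrightarrow>
        \<exists>w'. displacement ((T ^^ n) p) ((T ^^ n) q) w' \<and> norm (w' - torus_deriv (T ^^ n) p w) \<le> \<eta> * norm w"
      using displacement_linearisation[OF Tn \<eta>] by blast
    obtain B where B: "0 < B" "\<And>p v. norm (torus_deriv (T ^^ n) p v) \<le> B * norm v"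
      using torus_deriv_bounded[OF Tn] by blast
    have bound: "norm (?A (w i /\<^sub>R norm (w i))) \<le> C * \<alpha> ^ n + \<eta>"
      if i: "norm (w i) < min \<epsilon> (1 / (2 * (B + \<eta>)))" for i
    proof -
      obtain w' where w': "displacement ((T ^^ n) p) ((T ^^ n) (q i)) w'" "norm (w' - ?A (w i)) \<le> \<eta> * norm (w i)"
        using \<epsilon>(2)[OF qw(2)[of i]] i by auto
      have "norm w' \<le> norm (?A (w i)) + norm (w' - ?A (w i))" by (metis norm_triangle_sub)
      also have "\<dots> \<le> (B + \<eta>) * norm (w i)"
        using w'(2) B(2)[of p "w i"] by (simp add: distrib_right)
      also have "\<dots> \<le> (B + \<eta>) * (1 / (2 * (B + \<eta>)))"
        using i B(1) \<eta> by (intro mult_left_mono) auto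
      also have "\<dots> = 1 / 2" using B(1) \<eta> by simp
      finally have "norm w' = dist ((T ^^ n) p) ((T ^^ n) (q i))"
        using dist_eq_displacement[OF w'(1)] by simp
      also have "\<dots> \<le> C * \<alpha> ^ n * dist p (q i)" by (rule qw(4))
      also have "\<dots> \<le> C * \<alpha> ^ n * norm (w i)"
        using dist_le_displacement[OF qw(2)] C by (intro mult_left_mono) auto
      finally have "norm (?A (w i)) \<le> C * \<alpha> ^ n * norm (w i) + \<eta> * norm (w i)"
        using w'(2) norm_triangle_sub[of "?A (w i)" w'] by (simp add: norm_minus_commute)
      then have "norm (?A (w i)) \<le> (C * \<alpha> ^ n + \<eta>) * norm (w i)" by (simp add: distrib_right)
      moreover have "?A (w i /\<^sub>R norm (w i)) = ?A (w i) /\<^sub>R norm (w i)"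
        using lin by (simp add: linear_simps)
      ultimately show ?thesis using w0[of i] by (simp add: divide_simps mult.commute)
    qed
    have "0 < min \<epsilon> (1 / (2 * (B + \<eta>)))" using \<epsilon>(1) B(1) \<eta> by simp
    from small[OF this] have "\<forall>\<^sub>F i in sequentially. norm (w (r i)) < min \<epsilon> (1 / (2 * (B + \<eta>)))"
      by (rule eventually_subseq[OF r])
    then have "\<forall>\<^sub>F i in sequentially. norm (?A ((u \<circ> r) i)) \<le> C * \<alpha> ^ n + \<eta>"
      by (rule eventually_mono) (use bound in \<open>simp add: u_def\<close>)
    moreover have "(\<lambda>i. norm (?A ((u \<circ> r) i))) \<longlonglongrightarrow> norm (?A e)"
      using bounded_linear.tendsto[OF lin lim] by (rule tendsto_norm)
    ultimately show "norm (?A e) \<le> C * \<alpha> ^ n + \<eta>"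
      by (intro tendsto_upperbound[OF _ _ sequentially_bot])
  qed
  then show thesis using e by (intro that[of e]) auto
qed

lemma nearby_parameter:
  assumes "continuous_on {0..1} (g :: real \<Rightarrow> 'a::metric_space)" "inj_on g {0..1}" "s \<in> {0..1}" "0 < \<delta>"
  obtains s' where "s' \<in> {0..1}" "g s' \<noteq> g s" "dist (g s) (g s') < \<delta>"
proof -
  obtain d where d: "0 < d" "\<And>x. x \<in> {0..1} \<Longrightarrow> dist x s < d \<Longrightarrow> dist (g x) (g s) < \<delta>"
    using assms unfolding continuous_on_iff by metis
  define s' where "s' = (if s \<le> 1 / 2 then s + min (d / 2) (1 / 2) else s - min (d / 2) (1 / 2))"
  have s': "s' \<in> {0..1}" "s' \<noteq> s" "dist s' s < d"
    using assms(3) d(1) by (auto simp: s'_def dist_real_def)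
  show thesis
    using s' d(2)[OF s'(1,3)] inj_onD[OF assms(2) _ s'(1) assms(3)]
    by (intro that[of s']) (auto simp: dist_commute)
qed

text \<open>The horizontal segment of a rectangle through \<open>p\<close> is connected and lies in the stable fibre, hence in the
local stable fibre, and it has points arbitrarily close to \<open>p\<close>. The vertical segment provides an
asymptotic partner of \<open>p\<close> for the other time direction.\<close>

lemma markov_partition_nearby:
  assumes "markov_partition S \<R>" "0 < \<delta>"
  shows "\<exists>q. q \<noteq> p \<and> dist p q < \<delta> \<and> same_local_stable_fibre S \<R> p q"
    and "\<exists>q. q \<noteq> p \<and> q \<in> stable_fibre (inv S) p"
proof -
  obtain R where R: "R \<in> \<R>" "p \<in> R" "is_rectangle S R"
    using assms(1) unfolding markov_partition_def by (metis UNIV_I UnionE)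
  then obtain h :: "real \<times> real \<Rightarrow> T2" where h: "continuous_on ({0..1} \<times> {0..1}) h"
      "inj_on h ({0..1} \<times> {0..1})" "h ` ({0..1} \<times> {0..1}) = R"
    and hor: "\<And>s s' t. s \<in> {0..1} \<Longrightarrow> s' \<in> {0..1} \<Longrightarrow> t \<in> {0..1} \<Longrightarrow> h (s', t) \<in> stable_fibre S (h (s, t))"
    and ver: "\<And>s t t'. s \<in> {0..1} \<Longrightarrow> t \<in> {0..1} \<Longrightarrow> t' \<in> {0..1} \<Longrightarrow> h (s, t') \<in> stable_fibre (inv S) (h (s, t))"
    unfolding is_rectangle_def by metis
  obtain s t where st: "s \<in> {0..1}" "t \<in> {0..1}" "p = h (s, t)"
    using R(2) h(3) by blast
  have cont: "continuous_on {0..1} (\<lambda>s. h (s, t))"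
    using st(2) by (intro continuous_on_compose2[OF h(1)] continuous_intros) auto
  have "inj_on (\<lambda>s. h (s, t)) {0..1}"
    using st(2) by (intro inj_onI) (auto dest: inj_onD[OF h(2)])
  from nearby_parameter[OF cont this st(1) assms(2)]
  obtain s' where s': "s' \<in> {0..1}" "h (s', t) \<noteq> h (s, t)" "dist (h (s, t)) (h (s', t)) < \<delta>"
    by blast
  have "connected ((\<lambda>s. h (s, t)) ` {0..1})"
    by (intro connected_continuous_image[OF cont] connected_Icc)
  moreover have "p \<in> (\<lambda>s. h (s, t)) ` {0..1}" using st by blast
  moreover have "(\<lambda>s. h (s, t)) ` {0..1} \<subseteq> stable_fibre S p \<inter> R"
    using hor[OF st(1) _ st(2)] st h(3) by auto
  ultimately have "(\<lambda>s. h (s, t)) ` {0..1} \<subseteq> local_stable_fibre S R p"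
    unfolding local_stable_fibre_def by (intro connected_component_maximal)
  then show "\<exists>q. q \<noteq> p \<and> dist p q < \<delta> \<and> same_local_stable_fibre S \<R> p q"
    using s' st(3) R(1) unfolding same_local_stable_fibre_def by blast
  obtain t' :: real where "t' \<in> {0..1}" "t' \<noteq> t"
    by (metis atLeastAtMost_iff order_refl zero_le_one zero_neq_one)
  then show "\<exists>q. q \<noteq> p \<and> q \<in> stable_fibre (inv S) p"
    using ver[OF st(1,2)] inj_onD[OF h(2), of "(s, t')" "(s, t)"] st by (intro exI[of _ "h (s, t')"]) auto
qed

lemma subspace_of_plane_line:
  fixes E F :: "(real^2) set"
  assumes "subspace E" "subspace F" "E \<inter> F = {0}" "F \<noteq> {0}" "e \<in> E" "e \<noteq> 0" "v \<in> E"
  obtains r where "v = r *\<^sub>R e"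
proof -
  have "dim E \<noteq> DIM(real^2)"
  proof
    assume "dim E = DIM(real^2)"
    then have "E = UNIV" using assms(1) dim_eq_full span_eq_iff by metis
    then show False using assms(3,4) by simp
  qed
  moreover have "dim E \<le> DIM(real^2)" by (rule dim_subset_UNIV)
  ultimately have "dim E \<le> 1" by simp
  then have "span {e} = span E"
    using assms by (intro dim_eq_span) (auto simp: dim_insert)
  then have "v \<in> span {e}" using assms(7) by (simp add: span_base)
  then show thesis using that by (auto simp: span_singleton)
qed

text \<open>The hyperbolicity constant \<open>\<mu>\<close> of the splitting may be larger than \<open>\<alpha>\<close>, so that it cannot provide the rate \<open>\<rho>\<close>. The
contraction by \<open>\<alpha>\<close> along local fibres is first transferred to the tangent line \<open>Eu\<close>, and the
cone argument carries it from there to the whole global fibre.\<close>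

lemma fibre_asymptotics_exponential:
  fixes S :: "T2 \<Rightarrow> T2"
  assumes anosov: "C2_anosov_diffeo S" and markov: "markov_partition S \<R>"
    and C: "0 < C" "0 < \<alpha>" "\<alpha> < \<rho>" "\<rho> < 1" and contr: "local_fibre_contraction S \<R> C \<alpha>"
    and asym: "(\<lambda>n. dist ((inv S ^^ n) \<theta>) ((inv S ^^ n) \<theta>')) \<longlonglongrightarrow> 0"
  obtains D where "\<And>n. dist ((inv S ^^ n) \<theta>) ((inv S ^^ n) \<theta>') \<le> D * \<rho> ^ n"
proof -
  obtain Es Eu c \<mu> where hyp: "hyperbolic_splitting S Es Eu c \<mu>"
    using hyperbolic_splitting_if_anosov[OF anosov] by blast
  interpret hyperbolic_splitting S Es Eu c \<mu> by (rule hyp)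
  interpret bwd: hyperbolic_splitting "inv S" Eu Es c \<mu> by (rule inverse_splitting)
  have Es_nonzero: "Es p \<noteq> {0}" for p
  proof
    assume Es: "Es p = {0}"
    \<comment> \<open>If \<open>Es p\<close> is trivial, no other point can be forward asymptotic to \<open>p\<close>, but the vertical segment contains one.\<close>
    obtain q where q: "q \<noteq> p" "q \<in> stable_fibre (inv S) p"
      using markov_partition_nearby(2)[OF markov zero_less_one] by blast
    have "(\<lambda>n. dist ((S ^^ n) p) ((S ^^ n) q)) \<longlonglongrightarrow> 0"
      using q(2) bij by (simp add: stable_fibre_def inv_inv_eq)
    moreover have "\<mu> < (\<mu> + 1) / 2" "(\<mu> + 1) / 2 < 1" "0 \<le> \<mu>" using rate by simp_all
    ultimately obtain n0 D a where a: "a \<in> Es ((S ^^ n0) p)"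
      "\<And>n. n0 \<le> n \<Longrightarrow> dist ((S ^^ n) p) ((S ^^ n) q) \<le> D * ((\<mu> + 1) / 2) ^ n * norm a"
      using asymptotic_imp_exponential[OF \<open>0 \<le> \<mu>\<close> \<open>\<mu> < (\<mu> + 1) / 2\<close> _ contract(1)] by blast
    have "a = 0"
      using a(1) Es linear_0[OF linear_deriv, of n0 p] unfolding funpow_invariant(1)[symmetric] by simp
    then have "(S ^^ n0) p = (S ^^ n0) q" using a(2)[of n0] by simp
    then show False using q(1) funpow_inv_cancel(1) by metis
  qed
  \<comment> \<open>The maximum with \<open>1\<close> includes the case \<open>n = 0\<close>.\<close>
  define C' where "C' = max C 1"
  have rate_Eu: "norm (torus_deriv (inv S ^^ n) p v) \<le> C' * \<alpha> ^ n * norm v" if v: "v \<in> Eu p" for p v n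
  proof -
    have near: "\<exists>q. q \<noteq> p \<and> dist p q < \<delta> \<and>
        (\<forall>n. dist ((inv S ^^ n) p) ((inv S ^^ n) q) \<le> C' * \<alpha> ^ n * dist p q)" if \<delta>: "0 < \<delta>" for \<delta>
    proof -
      obtain q where q: "q \<noteq> p" "dist p q < \<delta>" "same_local_stable_fibre S \<R> p q"
        using markov_partition_nearby(1)[OF markov \<delta>] by blast
      have "dist ((inv S ^^ n) p) ((inv S ^^ n) q) \<le> C' * \<alpha> ^ n * dist p q" for n
      proof (cases "n = 0")
        case True
        have "1 * dist p q \<le> C' * dist p q" by (intro mult_right_mono) (auto simp: C'_def)
        then show ?thesis using True by simp
      next
        case False
        then have "dist ((inv S ^^ n) p) ((inv S ^^ n) q) \<le> C * \<alpha> ^ n * dist p q"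
          using contr q(3) by (simp add: local_fibre_contraction_def)
        also have "\<dots> \<le> C' * \<alpha> ^ n * dist p q"
          using C by (intro mult_right_mono) (auto simp: C'_def)
        finally show ?thesis .
      qed
      with q show ?thesis by blast
    qed
    have "0 \<le> C'" "0 \<le> \<alpha>" using C by (simp_all add: C'_def)
    then obtain e where e: "norm e = 1" "\<And>n. norm (torus_deriv (inv S ^^ n) p e) \<le> C' * \<alpha> ^ n"
      using secant_limit[OF bwd.C1(1) _ _ near] by blast
    have "norm (torus_deriv (inv S ^^ n) p e) \<le> C'" for n
    proof -
      have "C' * \<alpha> ^ n \<le> C' * 1" using C by (intro mult_left_mono power_le_one) (auto simp: C'_def)
      then show ?thesis using e(2)[of n] by linarith
    qed
    then have "e \<in> Eu p" by (rule bwd.bounded_orbit_imp_Es)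
    moreover have "e \<noteq> 0" using e(1) by force
    ultimately obtain r where r: "v = r *\<^sub>R e"
      using subspace_of_plane_line[OF subspaces(2) subspaces(1) bwd.disjoint Es_nonzero _ _ v] by blast
    have "norm (torus_deriv (inv S ^^ n) p v) = \<bar>r\<bar> * norm (torus_deriv (inv S ^^ n) p e)"
      unfolding r linear_scale[OF bwd.linear_deriv] by simp
    also have "\<dots> \<le> \<bar>r\<bar> * (C' * \<alpha> ^ n)" using e(2) by (intro mult_left_mono) auto
    finally show ?thesis using e(1) by (simp add: r mult_ac)
  qed
  obtain n0 D a where D: "\<And>n. n0 \<le> n \<Longrightarrow>
      dist ((inv S ^^ n) \<theta>) ((inv S ^^ n) \<theta>') \<le> D * \<rho> ^ n * norm (a :: real^2)"
    using bwd.asymptotic_imp_exponential[of \<alpha> \<rho> C' \<theta> \<theta>', OF less_imp_le[OF C(2)] C(3,4) rate_Eu asym] by blast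
  \<comment> \<open>The sum takes care of the finitely many times before \<open>n0\<close>.\<close>
  define D' where "D' = \<bar>D\<bar> * norm a + (\<Sum>n<n0. dist ((inv S ^^ n) \<theta>) ((inv S ^^ n) \<theta>') / \<rho> ^ n)"
  have \<rho>: "0 < \<rho>" using C by linarith
  have "dist ((inv S ^^ n) \<theta>) ((inv S ^^ n) \<theta>') \<le> D' * \<rho> ^ n" for n
  proof (cases "n0 \<le> n")
    case True
    have "D * norm a \<le> D'"
    proof -
      have "D * norm a \<le> \<bar>D\<bar> * norm a" by (intro mult_right_mono) auto
      moreover have "0 \<le> (\<Sum>n<n0. dist ((inv S ^^ n) \<theta>) ((inv S ^^ n) \<theta>') / \<rho> ^ n)"
        using \<rho> by (intro sum_nonneg) auto
      ultimately show ?thesis by (simp add: D'_def)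
    qed
    then have "D * norm a * \<rho> ^ n \<le> D' * \<rho> ^ n" using \<rho> by (intro mult_right_mono) auto
    then show ?thesis using D[OF True] by (simp add: mult_ac)
  next
    case False
    have "dist ((inv S ^^ n) \<theta>) ((inv S ^^ n) \<theta>') / \<rho> ^ n \<le> (\<Sum>n<n0. dist ((inv S ^^ n) \<theta>) ((inv S ^^ n) \<theta>') / \<rho> ^ n)"
      using False \<rho> by (intro member_le_sum) auto
    also have "\<dots> \<le> D'" by (simp add: D'_def)
    finally show ?thesis using \<rho> by (simp add: pos_divide_le_eq)
  qed
  then show thesis by (rule that)
qed

section \<open>Stable fibres of pinch points\<close>

theorem theorem2p18:
  fixes S :: "T2 \<Rightarrow> T2" and f :: "T2 \<Rightarrow> real \<Rightarrow> real" and M :: real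
    and \<R> :: "T2 set set" and T :: "T1 \<Rightarrow> T1" and J :: "(real \<times> real) set"
    and \<pi> :: "T2 \<Rightarrow> T1" and \<sigma> :: "T1 \<Rightarrow> T2" and C \<alpha> :: real
  assumes "C2_anosov_diffeo S"
    and "fibre_maps M f"
    and "lipschitz_fibres M f"
    and "markov_factor S \<R> T J \<pi> \<sigma>"
    and "0 < C" and "0 < \<alpha>" and "\<alpha> < 1"
    and "local_fibre_contraction S \<R> C \<alpha>"
    and "ereal \<alpha> * Q_sup M f < 1" and "Q'_sup M f < \<infinity>"
  shows "pinch_points S f M = (\<Union>\<theta>\<in>pinch_points S f M. stable_fibre S \<theta>) \<and>
    (\<forall>\<theta>\<in>pinch_points S f M. \<forall>\<theta>'.
       (\<lambda>n. dist ((inv S ^^ n) \<theta>) ((inv S ^^ n) \<theta>')) \<longlonglongrightarrow> 0 \<longrightarrow> \<theta>' \<in> pinch_points S f M)"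
proof -
  have bij: "bij S" using assms(1) by (simp add: C2_anosov_diffeo_def C2_torus_diffeo_def)
  have markov: "markov_partition S \<R>" using assms(4) by (simp add: markov_factor_def)
  obtain Q where Q: "Q_sup M f \<le> ereal Q" "0 < Q" "\<alpha> * Q < 1"
  proof (cases "Q_sup M f")
    case (real r)
    then have "\<alpha> * r < 1" using assms(9) by (simp add: one_ereal_def)
    moreover have "\<alpha> * (1 / 2) < 1" using assms(7) by simp
    ultimately show ?thesis using real by (intro that[of "max r (1 / 2)"]) (auto simp: max_def)
  next
    case PInf
    then show ?thesis using assms(6,9) by simp
  next
    case MInf
    then show ?thesis using assms(7) by (intro that[of 1]) auto
  qed
  obtain \<rho> where \<rho>: "\<alpha> < \<rho>" "\<rho> < 1" "\<rho> * Q < 1"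
  proof -
    have "\<alpha> < min 1 (1 / Q)" using assms(7) Q(2,3) by (simp add: pos_less_divide_eq)
    then obtain \<rho> where "\<alpha> < \<rho>" "\<rho> < min 1 (1 / Q)" using dense by blast
    then show thesis using Q(2) by (intro that[of \<rho>]) (simp_all add: pos_less_divide_eq)
  qed
  have main: "\<theta>' \<in> pinch_points S f M" if \<theta>: "\<theta> \<in> pinch_points S f M"
    and asym: "(\<lambda>n. dist ((inv S ^^ n) \<theta>) ((inv S ^^ n) \<theta>')) \<longlonglongrightarrow> 0" for \<theta> \<theta>'
  proof -
    obtain D where "\<And>n. dist ((inv S ^^ n) \<theta>) ((inv S ^^ n) \<theta>') \<le> D * \<rho> ^ n"
      using fibre_asymptotics_exponential[OF assms(1) markov assms(5,6) \<rho>(1,2) assms(8) asym] by blast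
    moreover have "0 < \<rho>" using assms(6) \<rho>(1) by linarith
    ultimately show ?thesis
      using pinch_point_transfer[OF bij assms(2,3) Q(1) assms(10) _ \<rho>(2,3) _ \<theta>] by blast
  qed
  moreover have "\<theta> \<in> stable_fibre S \<theta>" for \<theta>
    by (simp add: stable_fibre_def)
  ultimately show ?thesis
    unfolding stable_fibre_def by blast
qed

end
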